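(* Let $L$ be a virtual link. Then the Wirtinger number of $L$ equals the virtual bridge number of $L$, i.e. $\omega(L)=\mathrm{vb}(L)$.
   Context: **Virtual links and Gauss diagrams.** A virtual link diagram is an immersion of $n$ circles into the 2-sphere whose double points are each marked as a classical crossing (with over/under information) or a virtual crossing. A virtual link is an equivalence class of such diagrams under planar isotopy and the extended Reidemeister moves (the classical Reidemeister moves, the purely virtual Reidemeister moves, and the mixed move sliding a strand with two virtual crossings past a classical crossing). Given an oriented virtual link diagram, its Gauss diagram is the collection of oriented domain circles together with, for each classical crossing, a chord joining the two preimages of the crossing: a signed arrow from the over-crossing point (arrowtail) to the under-crossing point (arrowhead), the sign being the sign of the crossing. Every Gauss diagram comes from some virtual link diagram, and virtual links are in one-to-one correspondence with Gauss diagrams modulo (the Gauss diagram versions of) the classical Reidemeister moves. A Gauss diagram represents (is a Gauss diagram of) $L$ if it corresponds to $L$. **Standing assumption.** Only Gauss diagrams in which each circle component contains at least one arrowtail are considered (in particular, all minima below are over such diagrams). **Strands and bridge number.** A strand of a Gauss diagram $D$ is a subarc of a circle component from one arrowhead to the next (it contains no arrowheads in its interior, and finitely many, possibly zero, arrowtails); a circle component with no arrowheads counts as a single strand. Two strands are adjacent if they are separated by an arrowhead. An overbridge is a strand with at least one arrowtail on it. $\mathrm{vb}(D)$ is the number of overbridges of $D$, and the virtual bridge number $\mathrm{vb}(L)$ is the minimum of $\mathrm{vb}(D)$ over all Gauss diagrams $D$ of $L$. **Wirtinger number.** $D$ is $k$-partially colored if $k$ distinct colors have been assigned to a subset of the strands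 of $D$. Suppose $D_1$ is $k$-partially colored, and $c$ is a chord (of either sign) whose arrowtail lies on a colored strand, such that the strand $a_p$ on one side of the arrowhead of $c$ is colored and the strand $a_q$ on the other side of that arrowhead is not colored. A coloring move $D_1\to D_2$ extends the color of $a_p$ to $a_q$, giving a new $k$-partially colored diagram $D_2$. A Gauss diagram $D$ with $n$ strands is $k$-meridionally colorable if there are a $k$-partially colored diagram $D_0$ in which exactly $k$ strands (the seed strands) are colored, with $k$ distinct colors, and a sequence of coloring moves $D_0\to D_1\to\cdots\to D_{n-k}$ (so all strands of $D_{n-k}$ are colored). $\omega(D)$ is the minimum $k$ such that $D$ is $k$-meridionally colorable, and the Wirtinger number $\omega(L)$ is the minimum of $\omega(D)$ over all Gauss diagrams $D$ representing $L$. *)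

theory Defs
  imports
    "HOL-Library.Multiset"
    "HOL-Combinatorics.Transposition"
begin

section \<open>Gauss diagrams\<close>

text \<open>
  A Gauss diagram is stored as a Gauss code. The chords are labelled by natural numbers; the chord
  labelled \<open>c\<close> is the arrow from its over-crossing endpoint \<open>Tail c\<close> to its under-crossing endpoint
  \<open>Head c\<close>. Each oriented circle is the list of endpoints met along one turn, read cyclically, so
  that the empty list is a circle without endpoints. A sign is \<open>True\<close> for a positive crossing; its
  value at numbers that do not label a chord is irrelevant.
\<close>

datatype 'c endpoint = Tail (chord: 'c) | Head (chord: 'c)

datatype gauss_code =
  Gauss_Code (circles: "nat endpoint list list") (positive: "nat \<Rightarrow> bool")

definition endpoints :: "gauss_code \<Rightarrow> nat endpoint set" where
  "endpoints D = set (concat (circles D))"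

definition chords :: "gauss_code \<Rightarrow> nat set" where
  "chords D = chord ` endpoints D"

definition gauss_diagram :: "gauss_code \<Rightarrow> bool" where
  "gauss_diagram D \<longleftrightarrow> distinct (concat (circles D)) \<and>
     (\<forall>c. Tail c \<in> endpoints D \<longleftrightarrow> Head c \<in> endpoints D)"

text \<open>
  Codes of the same diagram differ by the labels of the chords, the base points of the circles and
  the order in which the circles are listed.
\<close>

definition gauss_iso :: "gauss_code \<Rightarrow> gauss_code \<Rightarrow> bool" where
  "gauss_iso D D' \<longleftrightarrow>
     (\<exists>f. inj_on f (chords D) \<and>
          (\<forall>c\<in>chords D. positive D' (f c) = positive D c) \<and>
          rel_mset (\<lambda>w w'. \<exists>n. w' = rotate n (map (map_endpoint f) w))
            (mset (circles D)) (mset (circles D')))"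

text \<open>
  The endpoint \<open>y\<close> comes directly after \<open>x\<close> on an oriented circle. If \<open>x\<close> is the only endpoint on
  its circle, it comes directly after itself.
\<close>

definition directly_after :: "gauss_code \<Rightarrow> nat endpoint \<Rightarrow> nat endpoint \<Rightarrow> bool" where
  "directly_after D x y \<longleftrightarrow>
     (\<exists>w\<in>set (circles D). \<exists>i<length w. x = w ! i \<and> y = w ! (Suc i mod length w))"

definition neighbours :: "gauss_code \<Rightarrow> nat endpoint \<Rightarrow> nat endpoint \<Rightarrow> bool" where
  "neighbours D x y \<longleftrightarrow> directly_after D x y \<or> directly_after D y x"


section \<open>Classical Reidemeister moves and virtual links\<close>

definition delete_chords :: "nat set \<Rightarrow> gauss_code \<Rightarrow> gauss_code" where
  "delete_chords C D =
     Gauss_Code (map (filter (\<lambda>x. chord x \<notin> C)) (circles D)) (positive D)"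

definition map_code :: "(nat endpoint \<Rightarrow> nat endpoint) \<Rightarrow> gauss_code \<Rightarrow> gauss_code" where
  "map_code \<pi> D = Gauss_Code (map (map \<pi>) (circles D)) (positive D)"

text \<open>The order in which two neighbouring endpoints \<open>x\<close>, \<open>y\<close> are met: \<open>x\<close> first if \<open>\<sigma>\<close> holds.\<close>

definition met_in_order :: "gauss_code \<Rightarrow> bool \<Rightarrow> nat endpoint \<Rightarrow> nat endpoint \<Rightarrow> bool" where
  "met_in_order D \<sigma> x y \<longleftrightarrow> (if \<sigma> then directly_after D x y else directly_after D y x)"

text \<open>
  All oriented versions of the moves are included. \<open>R1\<close> and \<open>R2\<close> are read from the larger to the
  smaller diagram; the reverse directions are added by the symmetric closure below.

  In \<open>R2\<close> one arc passes over another at both crossings, which then have opposite signs, whether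
  the two arcs run in parallel or in opposite directions.

  In \<open>R3\<close> the chord \<open>a\<close> goes from the top to the middle arc, \<open>b\<close> from the top to the bottom arc
  and \<open>c\<close> from the middle to the bottom arc. The move exchanges the two endpoints on each of the
  three arcs. The conditions relating signs and orders say when the arcs bound a planar triangle:
  take three directed lines in the plane and let \<open>A\<close>, \<open>B\<close>, \<open>C\<close> be the crossings of \<open>a\<close>, \<open>b\<close>, \<open>c\<close>.
  Reading truth values as signs, so that equality of truth values is multiplication, the lines have
  the directions \<open>t (B - A)\<close>, \<open>m (C - A)\<close>, \<open>u (C - B)\<close>. As a crossing has the sign of the
  determinant of its over- and under-direction, the signs of \<open>a\<close>, \<open>b\<close>, \<open>c\<close> are \<open>t m \<Delta>\<close>, \<open>t u \<Delta>\<close>,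
  \<open>m u \<Delta>\<close>, where \<open>\<Delta>\<close> is the orientation of the triangle \<open>A B C\<close>. Such a \<open>\<Delta>\<close> exists iff the two
  conditions stated hold.
\<close>

inductive reidemeister :: "gauss_code \<Rightarrow> gauss_code \<Rightarrow> bool" where
  R1: "\<lbrakk>c \<in> chords D; neighbours D (Tail c) (Head c)\<rbrakk>
       \<Longrightarrow> reidemeister D (delete_chords {c} D)"
| R2: "\<lbrakk>c \<in> chords D; d \<in> chords D; c \<noteq> d; positive D c \<noteq> positive D d;
        neighbours D (Tail c) (Tail d); neighbours D (Head c) (Head d)\<rbrakk>
       \<Longrightarrow> reidemeister D (delete_chords {c, d} D)"
| R3: "\<lbrakk>distinct [a, b, c]; {a, b, c} \<subseteq> chords D;
        met_in_order D t (Tail a) (Tail b);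
        met_in_order D m (Head a) (Tail c);
        met_in_order D u (Head b) (Head c);
        (positive D a = positive D b) = (m = u);
        (positive D b = positive D c) = (t = m)\<rbrakk>
       \<Longrightarrow> reidemeister D (map_code (transpose (Tail a) (Tail b) \<circ>
             transpose (Head a) (Tail c) \<circ> transpose (Head b) (Head c)) D)"

definition gauss_step :: "gauss_code \<Rightarrow> gauss_code \<Rightarrow> bool" where
  "gauss_step D D' \<longleftrightarrow>
     gauss_diagram D \<and> gauss_diagram D' \<and> (gauss_iso D D' \<or> reidemeister D D')"

definition gauss_equiv :: "(gauss_code \<times> gauss_code) set" where
  "gauss_equiv = {(D, D'). gauss_diagram D \<and> gauss_diagram D' \<and> equivclp gauss_step D D'}"

text \<open>
  Virtual links are in one-to-one correspondence with Gauss diagrams modulo the classical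
  Reidemeister moves, so a virtual link is taken to be the class of all Gauss diagrams that
  represent it; \<open>D\<close> represents \<open>L\<close> iff \<open>D \<in> L\<close>.
\<close>

definition virtual_links :: "gauss_code set set" where
  "virtual_links = {D. gauss_diagram D} // gauss_equiv"

text \<open>The diagrams over which the minima are taken.\<close>

definition tail_on_each_circle :: "gauss_code \<Rightarrow> bool" where
  "tail_on_each_circle D \<longleftrightarrow> (\<forall>w\<in>set (circles D). \<exists>c. Tail c \<in> set w)"


section \<open>Strands and bridge number\<close>

text \<open>
  \<open>Arc b\<close> is the strand that starts at the arrowhead of the chord \<open>b\<close>; \<open>Circle i\<close> is the strand
  formed by the whole circle at position \<open>i\<close> of the code, if that circle has no arrowheads.
\<close>

datatype strand = Arc nat | Circle nat

definition strands :: "gauss_code \<Rightarrow> strand set" where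
  "strands D = Arc ` chords D \<union>
     Circle ` {i. i < length (circles D) \<and> (\<forall>c. Head c \<notin> set (circles D ! i))}"

text \<open>
  Leaving the arrowhead of \<open>b\<close> along its circle, the endpoint \<open>x\<close> is met before or at the next
  arrowhead. For \<open>x = Head c\<close> this says that \<open>Arc b\<close> ends at the arrowhead of \<open>c\<close>; here \<open>c = b\<close>
  if there is only one arrowhead on the circle.
\<close>

inductive along_arc :: "gauss_code \<Rightarrow> nat \<Rightarrow> nat endpoint \<Rightarrow> bool" for D b where
  first: "directly_after D (Head b) x \<Longrightarrow> along_arc D b x"
| pass_tail: "\<lbrakk>along_arc D b (Tail c); directly_after D (Tail c) x\<rbrakk> \<Longrightarrow> along_arc D b x"

fun tail_on_strand :: "gauss_code \<Rightarrow> nat \<Rightarrow> strand \<Rightarrow> bool" where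
  "tail_on_strand D c (Arc b) \<longleftrightarrow> along_arc D b (Tail c)"
| "tail_on_strand D c (Circle i) \<longleftrightarrow> i < length (circles D) \<and> Tail c \<in> set (circles D ! i)"

definition overbridges :: "gauss_code \<Rightarrow> strand set" where
  "overbridges D = {s \<in> strands D. \<exists>c\<in>chords D. tail_on_strand D c s}"

definition vb_diagram :: "gauss_code \<Rightarrow> nat" where
  "vb_diagram D = card (overbridges D)"

definition virtual_bridge_number :: "gauss_code set \<Rightarrow> nat" where
  "virtual_bridge_number L = Inf (vb_diagram ` {D \<in> L. tail_on_each_circle D})"


section \<open>Wirtinger number\<close>

type_synonym coloring = "strand \<rightharpoonup> nat"

definition partially_colored :: "nat \<Rightarrow> gauss_code \<Rightarrow> coloring \<Rightarrow> bool" where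
  "partially_colored k D col \<longleftrightarrow> dom col \<subseteq> strands D \<and> card (ran col) = k"

text \<open>\<open>p\<close> and \<open>q\<close> are the strands on the two sides of the arrowhead of \<open>c\<close>, in either order.\<close>

definition adjacent_at :: "gauss_code \<Rightarrow> nat \<Rightarrow> strand \<Rightarrow> strand \<Rightarrow> bool" where
  "adjacent_at D c p q \<longleftrightarrow>
     (\<exists>b\<in>chords D. along_arc D b (Head c) \<and> (p = Arc b \<and> q = Arc c \<or> p = Arc c \<and> q = Arc b))"

definition coloring_move :: "gauss_code \<Rightarrow> coloring \<Rightarrow> coloring \<Rightarrow> bool" where
  "coloring_move D col col' \<longleftrightarrow>
     (\<exists>c\<in>chords D. \<exists>p q.
        (\<exists>s\<in>dom col. tail_on_strand D c s) \<and>
        adjacent_at D c p q \<and> p \<in> dom col \<and> q \<notin> dom col \<and>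
        col' = col(q := col p))"

definition meridionally_colorable :: "nat \<Rightarrow> gauss_code \<Rightarrow> bool" where
  "meridionally_colorable k D \<longleftrightarrow>
     (\<exists>col col'. partially_colored k D col \<and> card (dom col) = k \<and>
        (coloring_move D ^^ (card (strands D) - k)) col col' \<and> dom col' = strands D)"

definition wirtinger_diagram :: "gauss_code \<Rightarrow> nat" where
  "wirtinger_diagram D = Inf {k. meridionally_colorable k D}"

definition wirtinger_number :: "gauss_code set \<Rightarrow> nat" where
  "wirtinger_number L = Inf (wirtinger_diagram ` {D \<in> L. tail_on_each_circle D})"


section \<open>The minima are taken over nonempty sets\<close>

lemma finite_chords: "finite (chords D)"
  by (simp add: chords_def endpoints_def)

lemma finite_strands: "finite (strands D)"
  by (simp add: strands_def finite_chords)

lemma equiv_gauss_equiv: "equiv {D. gauss_diagram D} gauss_equiv"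
  unfolding gauss_equiv_def
  by (rule equivI)
    (auto simp: refl_on_def sym_def trans_def intro: equivclp_sym equivclp_trans)

lemma meridionally_colorable_card_strands: "meridionally_colorable (card (strands D)) D"
proof -
  obtain f :: "strand \<Rightarrow> nat" where f: "inj_on f (strands D)"
    using finite_imp_inj_to_nat_seg[OF finite_strands] by blast
  define col where "col s = (if s \<in> strands D then Some (f s) else None)" for s
  have dom: "dom col = strands D"
    by (auto simp: col_def dom_def)
  have "ran col = f ` strands D"
    by (auto simp: col_def ran_def)
  then have "card (ran col) = card (strands D)"
    using f by (simp add: card_image)
  with dom show ?thesis
    unfolding meridionally_colorable_def partially_colored_def
    by (intro exI[of _ col]) simp
qed

lemma ex_equiv_tail_on_each_circle:
  assumes "gauss_diagram D"
  shows "\<exists>D'. (D, D') \<in> gauss_equiv \<and> tail_on_each_circle D'"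
  using assms
proof (induction "length (filter (\<lambda>w. \<forall>c. Tail c \<notin> set w) (circles D))"
    arbitrary: D rule: less_induct)
  case less
  show ?case
  proof (cases "tail_on_each_circle D")
    case True
    then show ?thesis
      using less.prems by (auto simp: gauss_equiv_def)
  next
    case False
    then obtain w where "w \<in> set (circles D)" and w: "\<forall>c. Tail c \<notin> set w"
      by (auto simp: tail_on_each_circle_def)
    then obtain us vs where D: "circles D = us @ w # vs"
      by (meson split_list)
    obtain c where c: "c \<notin> chords D"
      using ex_new_if_finite[OF infinite_UNIV_nat finite_chords] by blast
    define w' where "w' = w @ [Tail c, Head c]"
    define D' where "D' = Gauss_Code (us @ w' # vs) (positive D)"
    have new: "x \<in> endpoints D \<Longrightarrow> chord x \<noteq> c" for x
      using c by (auto simp: chords_def)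
    have keep: "filter (\<lambda>x. chord x \<noteq> c) v = v" if "v \<in> set (circles D)" for v
      using that new by (auto simp: endpoints_def filter_id_conv)
    have "endpoints D' = endpoints D \<union> {Tail c, Head c}"
      by (auto simp: endpoints_def D'_def w'_def D)
    moreover have "distinct (concat (circles D'))"
    proof -
      have "Tail c \<notin> endpoints D" "Head c \<notin> endpoints D"
        using new by force+
      then show ?thesis
        using less.prems by (auto simp: gauss_diagram_def endpoints_def D'_def w'_def D)
    qed
    ultimately have D': "gauss_diagram D'"
      using less.prems by (auto simp: gauss_diagram_def)
    have "map (filter (\<lambda>x. chord x \<noteq> c)) us = us" "map (filter (\<lambda>x. chord x \<noteq> c)) vs = vs"
      "filter (\<lambda>x. chord x \<noteq> c) w = w"
      using keep by (auto simp: D intro!: map_idI)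
    then have "delete_chords {c} D' = D"
      by (cases D) (use D in \<open>simp add: delete_chords_def D'_def w'_def\<close>)
    moreover have "directly_after D' (Tail c) (Head c)"
      unfolding directly_after_def
      by (rule bexI[of _ w'], rule exI[of _ "length w"])
        (auto simp: D'_def w'_def nth_append)
    moreover have "c \<in> chords D'"
      by (force simp: chords_def endpoints_def D'_def w'_def)
    ultimately have "reidemeister D' D"
      using R1[of c D'] by (auto simp: neighbours_def)
    then have step: "(D, D') \<in> gauss_equiv"
      using D' less.prems
      by (auto simp: gauss_equiv_def gauss_step_def intro!: equivclp_sym[OF r_into_equivclp])
    have "length (filter (\<lambda>w. \<forall>c. Tail c \<notin> set w) (circles D')) <
        length (filter (\<lambda>w. \<forall>c. Tail c \<notin> set w) (circles D))"
      using w by (auto simp: D D'_def w'_def)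
    then obtain D'' where "(D', D'') \<in> gauss_equiv" "tail_on_each_circle D''"
      using less.hyps D' by blast
    with step show ?thesis
      using equiv_gauss_equiv by (meson equivE transE)
  qed
qed

lemma virtual_link_has_tail_on_each_circle:
  assumes "L \<in> virtual_links"
  shows "\<exists>D\<in>L. tail_on_each_circle D"
  using assms ex_equiv_tail_on_each_circle
  by (force simp: virtual_links_def elim!: quotientE)

end

theory Submission
  imports Defs
begin

text \<open>
  \<^bold>\<open>The Wirtinger number is at most the bridge number.\<close> In a diagram with a tail on each circle take
  the overbridges as seeds. All tails then lie on coloured strands, so the colour of a strand can
  always be extended past the arrowhead at either of its ends. As every circle carries an overbridge,
  the colours spread over all circles (\<open>meridionally_colorable_vb\<close>).

  \<^bold>\<open>The bridge number is at most the Wirtinger number.\<close> Number the strands of a coloured diagram in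
  the order in which they receive a colour, the seeds first. If the last strand is not a seed, it was
  coloured across the arrowhead of some chord \<open>c\<close>, from a strand with a smaller number, and the tail
  of \<open>c\<close> lies on a strand with a smaller number too. A tail on the last strand that is next to this
  arrowhead, say of a chord \<open>e\<close>, can be pushed across it at the price of conjugating the arrowhead
  of \<open>e\<close>: a second Reidemeister move introduces two chords \<open>f\<close>, \<open>g\<close> of opposite signs from the
  strand of the tail of \<open>c\<close> to the neighbourhood of the arrowhead of \<open>e\<close>, and a third Reidemeister
  move on \<open>c\<close>, \<open>f\<close>, \<open>e\<close> carries the tail of \<open>e\<close> across the arrowhead of \<open>c\<close>
  (\<open>gauss_equiv_reroute\<close>). The two new tails lie on a strand with a smaller number, and the two new
  strands at the arrowhead of \<open>e\<close> carry no tails. The colouring moves up to the previous stage do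
  not use \<open>e\<close>, whose tail was on the last strand. So one can repeat the step until the last strand
  is free of tails, then do the same with the strand before it, and so on (\<open>lower_levels\<close>). In the
  end all tails lie on seeds, and there are no more overbridges than seeds.

  The second part is carried out with levels of the gaps between consecutive endpoints of a circle
  instead of strands: each gap is labelled by the number of its strand. This makes the bookkeeping
  local: rerouting changes only the labels at \<open>e\<close> and creates those at \<open>f\<close> and \<open>g\<close>, whereas strands
  are cut and get new names.
\<close>

section \<open>Going round a circle\<close>

lemma circle_unique:
  assumes "gauss_diagram D" "w \<in> set (circles D)" "w' \<in> set (circles D)" "x \<in> set w" "x \<in> set w'"
  shows "w = w'"
  using assms by (force simp: gauss_diagram_def distinct_concat_iff)

lemma distinct_circle: "gauss_diagram D \<Longrightarrow> w \<in> set (circles D) \<Longrightarrow> distinct w"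
  by (simp add: gauss_diagram_def distinct_concat_iff)

lemma circle_of_endpoint:
  assumes "x \<in> endpoints D"
  obtains w where "w \<in> set (circles D)" "x \<in> set w"
  using assms by (auto simp: endpoints_def)

lemma directly_after_circle:
  assumes "directly_after D x y"
  obtains w where "w \<in> set (circles D)" "x \<in> set w" "y \<in> set w"
proof -
  obtain w i where "w \<in> set (circles D)" "i < length w" "x = w ! i" "y = w ! (Suc i mod length w)"
    using assms by (auto simp: directly_after_def)
  moreover from this have "Suc i mod length w < length w"
    by (intro mod_less_divisor) auto
  ultimately show thesis
    using that by simp
qed

lemma chords_iff_Tail: "gauss_diagram D \<Longrightarrow> c \<in> chords D \<longleftrightarrow> Tail c \<in> endpoints D"
  unfolding chords_def gauss_diagram_def
  by (metis (no_types, lifting) endpoint.exhaust endpoint.sel(1,2) image_iff)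

lemma chords_iff_Head: "gauss_diagram D \<Longrightarrow> c \<in> chords D \<longleftrightarrow> Head c \<in> endpoints D"
  using chords_iff_Tail by (auto simp: gauss_diagram_def)

lemma directly_after_endpoints:
  assumes "directly_after D x y"
  shows "x \<in> endpoints D" "y \<in> endpoints D"
  using directly_after_circle[OF assms] by (auto simp: endpoints_def)

lemma directly_after_unique_right:
  assumes D: "gauss_diagram D" and "directly_after D x y" "directly_after D x z"
  shows "y = z"
proof -
  obtain w i w' j where "w \<in> set (circles D)" "i < length w" "x = w ! i" "y = w ! (Suc i mod length w)"
    "w' \<in> set (circles D)" "j < length w'" "x = w' ! j" "z = w' ! (Suc j mod length w')"
    using assms by (auto simp: directly_after_def)
  moreover from this have "w = w'"
    using circle_unique[OF D] by (metis nth_mem)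
  ultimately show ?thesis
    using distinct_circle[OF D] by (metis nth_eq_iff_index_eq)
qed

lemma Suc_mod_inj:
  assumes "i < n" "j < n" "Suc i mod n = Suc j mod n"
  shows "i = j"
  using assms by (auto simp: mod_Suc split: if_splits)

lemma directly_after_unique_left:
  assumes D: "gauss_diagram D" and "directly_after D x z" "directly_after D y z"
  shows "x = y"
proof -
  obtain w i w' j where *: "w \<in> set (circles D)" "i < length w" "x = w ! i" "z = w ! (Suc i mod length w)"
    "w' \<in> set (circles D)" "j < length w'" "y = w' ! j" "z = w' ! (Suc j mod length w')"
    using assms by (auto simp: directly_after_def)
  have less: "Suc i mod length w < length w" "Suc j mod length w' < length w'"
    using * by (auto intro!: mod_less_divisor)
  then have "w = w'"
    using circle_unique[OF D] * by (metis nth_mem)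
  moreover from this have "Suc i mod length w = Suc j mod length w"
    using * less distinct_circle[OF D] by (metis nth_eq_iff_index_eq)
  ultimately show ?thesis
    using * Suc_mod_inj by metis
qed

lemma ex_directly_after:
  assumes "y \<in> endpoints D"
  shows "\<exists>x. directly_after D x y"
proof -
  obtain w j where w: "w \<in> set (circles D)" "j < length w" "y = w ! j"
    using assms by (metis circle_of_endpoint in_set_conv_nth)
  define i where "i = (if j = 0 then length w - 1 else j - 1)"
  have "i < length w" "Suc i mod length w = j"
    using w by (auto simp: i_def)
  then show ?thesis
    using w by (auto simp: directly_after_def)
qed

text \<open>
  Induction round a circle: walking forwards from \<open>x\<close> one comes to all its endpoints.
\<close>

lemma circle_propagate:
  assumes w: "w \<in> set (circles D)" and x: "x \<in> set w" "S x" and y: "y \<in> set w"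
    and step: "\<And>x y. directly_after D x y \<Longrightarrow> S x \<Longrightarrow> S y"
  shows "S y"
proof -
  obtain i j where i: "i < length w" "x = w ! i" and j: "j < length w" "y = w ! j"
    using x y by (metis in_set_conv_nth)
  have "S (w ! ((i + k) mod length w))" for k
  proof (induction k)
    case 0
    then show ?case using i x by simp
  next
    case (Suc k)
    have "(i + k) mod length w < length w"
      using i by (intro mod_less_divisor) auto
    then have "directly_after D (w ! ((i + k) mod length w)) (w ! ((i + Suc k) mod length w))"
      using w unfolding directly_after_def by (metis add_Suc_right mod_Suc_eq)
    then show ?case using Suc step by blast
  qed
  from this[of "j + length w - i"] show ?thesis
    using i j by simp
qed

text \<open>
  With \<open>directly_afterE\<close> this turns the cyclic relation into adjacency in a rotated word. Words can be
  edited there without treating the base point separately, since replacing endpoints by words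
  commutes with rotation.
\<close>

lemma directly_afterI:
  assumes w: "w \<in> set (circles D)" and rot: "rotate n w = p @ x # y # r"
  shows "directly_after D x y"
proof -
  define m where "m = n + length p"
  have len: "length w = length p + Suc (Suc (length r))"
    using arg_cong[OF rot, of length] by simp
  have "x = w ! (m mod length w)" "y = w ! (Suc m mod length w)"
    using nth_rotate[of "length p" w n] nth_rotate[of "Suc (length p)" w n] rot len
    by (simp_all add: m_def nth_append)
  moreover have "Suc m mod length w = Suc (m mod length w) mod length w"
    by (simp only: mod_Suc_eq)
  moreover have "m mod length w < length w"
    using len by (intro mod_less_divisor) linarith
  ultimately show ?thesis
    using w unfolding directly_after_def by metis
qed

lemma directly_afterE:
  assumes "directly_after D x y" "x \<noteq> y"
  obtains u v r where "u @ v \<in> set (circles D)" "v @ u = x # y # r"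
proof -
  obtain w i where w: "w \<in> set (circles D)" "i < length w" "x = w ! i" "y = w ! (Suc i mod length w)"
    using assms by (auto simp: directly_after_def)
  have split: "w = take i w @ x # drop (Suc i) w"
    using w by (simp add: id_take_nth_drop)
  show thesis
  proof (cases "Suc i < length w")
    case True
    then have "drop (Suc i) w = y # drop (Suc (Suc i)) w"
      using w by (simp add: Cons_nth_drop_Suc)
    then have "drop i w @ take i w = x # y # (drop (Suc (Suc i)) w @ take i w)"
      using w by (simp add: Cons_nth_drop_Suc[symmetric])
    then show thesis
      using that[of "take i w" "drop i w"] w by (simp only: append_take_drop_id)
  next
    case False
    then have Suc_i: "Suc i = length w" using w by simp
    then have "y = w ! 0" using w by simp
    moreover have "i \<noteq> 0"
      using \<open>y = w ! 0\<close> assms w by metis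
    ultimately have "take i w = y # drop 1 (take i w)"
      using w by (cases w; cases i) auto
    moreover have "drop i w = [x]"
      using w Suc_i by (simp add: Cons_nth_drop_Suc[symmetric])
    ultimately have "drop i w @ take i w = x # y # drop 1 (take i w)"
      by simp
    then show thesis
      using that[of "take i w" "drop i w"] w by (simp only: append_take_drop_id)
  qed
qed

section \<open>Strands\<close>

lemma along_arc_circle:
  assumes "along_arc D b x" "gauss_diagram D"
  shows "\<exists>w\<in>set (circles D). Head b \<in> set w \<and> x \<in> set w"
  using assms
proof (induction rule: along_arc.induct)
  case (first x)
  then show ?case by (meson directly_after_circle)
next
  case (pass_tail c x)
  then show ?case by (metis circle_unique directly_after_circle)
qed

lemma along_arc_pass_tail_iff:
  assumes D: "gauss_diagram D" and xy: "directly_after D (Tail c) x"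
  shows "along_arc D b x \<longleftrightarrow> along_arc D b (Tail c)"
proof
  assume "along_arc D b x"
  then show "along_arc D b (Tail c)"
  proof cases
    case first
    then show ?thesis using directly_after_unique_left[OF D xy] by blast
  next
    case (pass_tail d)
    then show ?thesis using directly_after_unique_left[OF D xy] by blast
  qed
qed (rule along_arc.pass_tail[OF _ xy])

text \<open>
  Arcs cannot merge: the walk from an arrowhead can be retraced, and it is stopped by the first
  arrowhead met on the way back.
\<close>

lemma along_arc_unique:
  assumes D: "gauss_diagram D" and "along_arc D b x" "along_arc D b' x"
  shows "b = b'"
  using assms(2,3)
proof (induction rule: along_arc.induct)
  case (first x)
  from first(2) show ?case
    by cases (use directly_after_unique_left[OF D first(1)] in blast)+
next
  case (pass_tail c x)
  then show ?case using along_arc_pass_tail_iff[OF D] by blast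
qed

text \<open>
  On a circle with an arrowhead every tail lies on an arc; this property of endpoints, made true for
  arrowheads by convention, is propagated round the circle.
\<close>

lemma ex_along_arc:
  assumes "gauss_diagram D" "w \<in> set (circles D)" "Head b \<in> set w" "Tail c \<in> set w"
  shows "\<exists>a\<in>chords D. along_arc D a (Tail c)"
proof -
  have "case_endpoint (\<lambda>c. \<exists>a\<in>chords D. along_arc D a (Tail c)) (\<lambda>_. True) (Tail c)"
  proof (rule circle_propagate[OF assms(2,3) _ assms(4)])
    fix x y
    assume xy: "directly_after D x y"
      and x: "case_endpoint (\<lambda>c. \<exists>a\<in>chords D. along_arc D a (Tail c)) (\<lambda>_. True) x"
    show "case_endpoint (\<lambda>c. \<exists>a\<in>chords D. along_arc D a (Tail c)) (\<lambda>_. True) y"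
    proof (cases x)
      case (Tail d)
      then obtain a where "a \<in> chords D" "along_arc D a y"
        using x xy along_arc.pass_tail by auto
      then show ?thesis by (auto split: endpoint.split)
    next
      case (Head d)
      moreover from this have "d \<in> chords D"
        using xy assms(1) chords_iff_Head directly_after_endpoints by blast
      ultimately show ?thesis
        using along_arc.first[of D d y] xy by (auto split: endpoint.split)
    qed
  qed simp
  then show ?thesis by simp
qed

lemma ex_strand_of_tail:
  assumes D: "gauss_diagram D" and c: "c \<in> chords D"
  shows "\<exists>s\<in>strands D. tail_on_strand D c s"
proof -
  obtain w where "w \<in> set (circles D)" "Tail c \<in> set w"
    using c chords_iff_Tail[OF D] circle_of_endpoint by blast
  then obtain i where i: "i < length (circles D)" "Tail c \<in> set (circles D ! i)"
    by (metis in_set_conv_nth)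
  show ?thesis
  proof (cases "\<exists>b. Head b \<in> set (circles D ! i)")
    case True
    then obtain a where "a \<in> chords D" "along_arc D a (Tail c)"
      using ex_along_arc[OF D _ _ i(2)] i(1) nth_mem by blast
    then show ?thesis
      by (intro bexI[of _ "Arc a"]) (auto simp: strands_def)
  next
    case False
    then show ?thesis
      using i by (intro bexI[of _ "Circle i"]) (auto simp: strands_def)
  qed
qed

section \<open>Overbridges as seeds\<close>

text \<open>
  If no move is possible, then the two strands at any arrowhead are both coloured or both uncoloured,
  because the tail of that chord lies on an overbridge. Hence each circle is coloured entirely or not
  at all; but it carries a tail, and so an overbridge.
\<close>

lemma ex_coloring_move:
  assumes D: "gauss_diagram D" and tails: "tail_on_each_circle D"
    and over: "overbridges D \<subseteq> dom col" and dom: "dom col \<subseteq> strands D" "dom col \<noteq> strands D"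
  shows "\<exists>q\<in>strands D - dom col. \<exists>col'. coloring_move D col col' \<and> dom col' = insert q (dom col)"
proof (rule ccontr)
  assume no_move: "\<not> ?thesis"
  have no_step: "q \<in> dom col" if "c \<in> chords D" "adjacent_at D c p q" "p \<in> dom col" for c p q
  proof (rule ccontr)
    assume q: "q \<notin> dom col"
    obtain s where "s \<in> strands D" "tail_on_strand D c s"
      using ex_strand_of_tail[OF D \<open>c \<in> chords D\<close>] by blast
    then have "\<exists>s\<in>dom col. tail_on_strand D c s"
      using over \<open>c \<in> chords D\<close> unfolding overbridges_def by blast
    then have "coloring_move D col (col(q := col p))"
      using that q unfolding coloring_move_def by blast
    moreover have "dom (col(q := col p)) = insert q (dom col)"
      using that by auto
    moreover have "q \<in> strands D"
      using that by (auto simp: adjacent_at_def strands_def)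
    ultimately show False
      using no_move q by blast
  qed
  \<comment> \<open>The gap after the endpoint belongs to a coloured arc.\<close>
  define S where "S = case_endpoint (\<lambda>c. \<exists>b. along_arc D b (Tail c) \<and> Arc b \<in> dom col)
    (\<lambda>b. Arc b \<in> dom col)"
  have S_step: "S y" if xy: "directly_after D x y" and "S x" for x y
  proof -
    obtain b where b: "along_arc D b y" "Arc b \<in> dom col"
    proof (cases x)
      case (Tail c)
      then show thesis
        using that \<open>S x\<close> xy along_arc.pass_tail[of D _ c y] by (auto simp: S_def)
    next
      case (Head c)
      then show thesis
        using that \<open>S x\<close> xy along_arc.first by (auto simp: S_def)
    qed
    show ?thesis
    proof (cases y)
      case (Tail c)
      then show ?thesis using b by (auto simp: S_def)
    next
      case (Head c)
      then have "c \<in> chords D"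
        using D chords_iff_Head directly_after_endpoints(2)[OF xy] by blast
      moreover have "b \<in> chords D"
        using b(2) dom by (auto simp: strands_def)
      ultimately have "Arc c \<in> dom col"
        using b Head by (intro no_step[of c "Arc b" "Arc c", OF _ _ b(2)]) (auto simp: adjacent_at_def)
      then show ?thesis using Head by (simp add: S_def)
    qed
  qed
  obtain q where q: "q \<in> strands D" "q \<notin> dom col"
    using dom by blast
  show False
  proof (cases q)
    case (Circle i)
    then have i: "i < length (circles D)" "circles D ! i \<in> set (circles D)"
      using q by (auto simp: strands_def)
    then obtain c where c: "Tail c \<in> set (circles D ! i)"
      using tails unfolding tail_on_each_circle_def by blast
    then have "Tail c \<in> endpoints D"
      using i by (auto simp: endpoints_def)
    then have "c \<in> chords D"
      using chords_iff_Tail[OF D] by blast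
    then have "q \<in> overbridges D"
      using c q(1) i Circle by (auto simp: overbridges_def)
    then show False using over q by blast
  next
    case (Arc b)
    then have "b \<in> chords D"
      using q by (auto simp: strands_def)
    then obtain w where w: "w \<in> set (circles D)" "Head b \<in> set w"
      using chords_iff_Head[OF D] circle_of_endpoint by blast
    obtain c where c: "Tail c \<in> set w"
      using tails w by (auto simp: tail_on_each_circle_def)
    then have "c \<in> chords D"
      using chords_iff_Tail[OF D] w by (auto simp: endpoints_def)
    moreover obtain a where a: "a \<in> chords D" "along_arc D a (Tail c)"
      using ex_along_arc[OF D w c] by blast
    ultimately have "Arc a \<in> overbridges D"
      by (auto simp: overbridges_def strands_def)
    then have "S (Tail c)"
      using over a by (auto simp: S_def)
    then have "S (Head b)"
      using circle_propagate[OF w(1) c _ w(2), of S] S_step by blast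
    then show False
      using q Arc by (auto simp: S_def)
  qed
qed

lemma color_all_from_overbridges:
  assumes D: "gauss_diagram D" and tails: "tail_on_each_circle D"
    and "overbridges D \<subseteq> dom col" "dom col \<subseteq> strands D"
  shows "\<exists>col'. (coloring_move D ^^ card (strands D - dom col)) col col' \<and> dom col' = strands D"
  using assms(3,4)
proof (induction "card (strands D - dom col)" arbitrary: col)
  case 0
  then have "dom col = strands D"
    using finite_strands by auto
  then show ?case by auto
next
  case (Suc m)
  then have "dom col \<noteq> strands D" by auto
  then obtain q col1 where q: "q \<in> strands D - dom col"
    and move: "coloring_move D col col1" and dom: "dom col1 = insert q (dom col)"
    using ex_coloring_move[OF D tails Suc.prems] by blast
  have "strands D - dom col1 = strands D - dom col - {q}"
    using dom by auto
  then have "m = card (strands D - dom col1)"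
    using Suc.hyps(2) q finite_strands by simp
  moreover have "overbridges D \<subseteq> dom col1" "dom col1 \<subseteq> strands D"
    using Suc.prems dom q by auto
  ultimately have "\<exists>col'. (coloring_move D ^^ m) col1 col' \<and> dom col' = strands D"
    using Suc.hyps(1) by simp
  then obtain col' where "(coloring_move D ^^ m) col1 col'" "dom col' = strands D"
    by blast
  with move have "(coloring_move D ^^ Suc m) col col'"
    by (intro relpowp_Suc_I2)
  then show ?case
    using \<open>dom col' = strands D\<close> unfolding Suc.hyps(2) by blast
qed

lemma meridionally_colorable_vb:
  assumes D: "gauss_diagram D" and tails: "tail_on_each_circle D"
  shows "meridionally_colorable (vb_diagram D) D"
proof -
  have sub: "overbridges D \<subseteq> strands D"
    by (auto simp: overbridges_def)
  then have fin: "finite (overbridges D)"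
    using finite_strands finite_subset by blast
  obtain f :: "strand \<Rightarrow> nat" where f: "inj_on f (strands D)"
    using finite_imp_inj_to_nat_seg[OF finite_strands] by blast
  define col where "col s = (if s \<in> overbridges D then Some (f s) else None)" for s
  have dom: "dom col = overbridges D"
    by (auto simp: col_def dom_def)
  have "ran col = f ` overbridges D"
    by (auto simp: col_def ran_def)
  moreover have "inj_on f (overbridges D)"
    using f sub inj_on_subset by blast
  ultimately have "partially_colored (vb_diagram D) D col"
    using dom sub by (simp add: partially_colored_def vb_diagram_def card_image)
  moreover have "card (strands D - dom col) = card (strands D) - vb_diagram D"
    using fin sub by (simp add: dom vb_diagram_def card_Diff_subset)
  moreover obtain col' where "(coloring_move D ^^ card (strands D - dom col)) col col'"
    "dom col' = strands D"
    using color_all_from_overbridges[OF D tails, of col] dom sub by auto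
  ultimately show ?thesis
    unfolding meridionally_colorable_def
    by (intro exI[of _ col] exI[of _ col']) (simp add: dom vb_diagram_def)
qed

lemma wirtinger_diagram_le_vb_diagram:
  assumes "gauss_diagram D" "tail_on_each_circle D"
  shows "wirtinger_diagram D \<le> vb_diagram D"
  using meridionally_colorable_vb[OF assms] unfolding wirtinger_diagram_def
  by (intro wellorder_Inf_le1) simp

section \<open>Moving a tail across an arrowhead\<close>

lemma circle_subset_endpoints: "w \<in> set (circles D) \<Longrightarrow> set w \<subseteq> endpoints D"
  by (auto simp: endpoints_def)

text \<open>
  Inserting chords and permuting endpoints inside short words are both substitutions of words for
  endpoints.
\<close>

definition expand :: "(nat endpoint \<Rightarrow> nat endpoint list) \<Rightarrow> (nat \<Rightarrow> bool) \<Rightarrow> gauss_code \<Rightarrow> gauss_code"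
  where "expand \<phi> p D = Gauss_Code (map (\<lambda>w. concat (map \<phi> w)) (circles D)) p"

lemma positive_expand [simp]: "positive (expand \<phi> p D) = p"
  by (simp add: expand_def)

lemma circles_expand: "circles (expand \<phi> p D) = map (\<lambda>w. concat (map \<phi> w)) (circles D)"
  by (simp add: expand_def)

lemma endpoints_expand: "endpoints (expand \<phi> p D) = (\<Union>x\<in>endpoints D. set (\<phi> x))"
  by (auto simp: endpoints_def circles_expand)

lemma directly_after_expand:
  assumes "directly_after D x y" "x \<noteq> y" "\<phi> x = us @ [x']" "\<phi> y = y' # vs"
  shows "directly_after (expand \<phi> p D) x' y'"
proof -
  obtain u v r where uv: "u @ v \<in> set (circles D)" "v @ u = x # y # r"
    using directly_afterE[OF assms(1,2)] by blast
  define F where "F w = concat (map \<phi> w)" for w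
  have "F u @ F v \<in> set (circles (expand \<phi> p D))"
    using imageI[OF uv(1), of F] by (simp add: circles_expand F_def)
  moreover have "rotate (length (F u)) (F u @ F v) = us @ x' # y' # vs @ F r"
    using arg_cong[OF uv(2), of F] assms by (simp add: F_def rotate_append)
  ultimately show ?thesis
    by (rule directly_afterI)
qed

lemma directly_after_within_expand:
  assumes "x \<in> endpoints D" "\<phi> x = us @ a # b # vs"
  shows "directly_after (expand \<phi> p D) a b"
proof -
  obtain w where w: "w \<in> set (circles D)" "x \<in> set w"
    using assms(1) circle_of_endpoint by blast
  then obtain w1 w2 where "w = w1 @ x # w2"
    by (meson split_list)
  then have "rotate 0 (concat (map \<phi> w)) = (concat (map \<phi> w1) @ us) @ a # b # vs @ concat (map \<phi> w2)"
    using assms by simp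
  moreover have "concat (map \<phi> w) \<in> set (circles (expand \<phi> p D))"
    using w by (simp add: circles_expand)
  ultimately show ?thesis
    by (intro directly_afterI)
qed

lemma distinct_concat_map:
  assumes "distinct xs" "\<And>x. x \<in> set xs \<Longrightarrow> distinct (\<phi> x)"
    "\<And>x y. x \<in> set xs \<Longrightarrow> y \<in> set xs \<Longrightarrow> x \<noteq> y \<Longrightarrow> set (\<phi> x) \<inter> set (\<phi> y) = {}"
  shows "distinct (concat (map \<phi> xs))"
  using assms
proof (induction xs)
  case (Cons x xs)
  have "set (\<phi> x) \<inter> (\<Union>y\<in>set xs. set (\<phi> y)) = {}"
    using Cons.prems(1) Cons.prems(3)[of x] by fastforce
  then show ?case
    using Cons by simp
qed simp

lemma distinct_expand:
  assumes "gauss_diagram D" "\<And>x. x \<in> endpoints D \<Longrightarrow> distinct (\<phi> x)"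
    "\<And>x y. x \<in> endpoints D \<Longrightarrow> y \<in> endpoints D \<Longrightarrow> x \<noteq> y \<Longrightarrow> set (\<phi> x) \<inter> set (\<phi> y) = {}"
  shows "distinct (concat (circles (expand \<phi> p D)))"
proof -
  have "concat (map (\<lambda>w. concat (map \<phi> w)) ws) = concat (map \<phi> (concat ws))" for ws
    by (induction ws) auto
  then show ?thesis
    using assms distinct_concat_map[of "concat (circles D)" \<phi>]
    by (simp add: circles_expand gauss_diagram_def endpoints_def)
qed

text \<open>
  The result of pushing a finger of the arc through the tail of \<open>c\<close> over the arrowhead of \<open>e\<close>, by a
  second Reidemeister move. The tail of \<open>f\<close> is put next to that of \<open>c\<close>, on the side given by \<open>t\<close>,
  and the head of \<open>f\<close> next to that of \<open>e\<close>, so that \<open>c\<close>, \<open>f\<close>, \<open>e\<close> are ready for a third move.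
\<close>

definition finger :: "bool \<Rightarrow> nat \<Rightarrow> nat \<Rightarrow> nat \<Rightarrow> nat \<Rightarrow> nat endpoint \<Rightarrow> nat endpoint list" where
  "finger t c e f g x =
     (if x = Tail c then (if t then [Tail c, Tail f, Tail g] else [Tail g, Tail f, Tail c])
      else if x = Head e then [Head g, Head f, Head e] else [x])"

text \<open>
  The third Reidemeister move applied to a finger: \<open>f\<close> changes places with \<open>c\<close> at its tail and with
  \<open>e\<close> at its head, and the tail of \<open>e\<close> changes places with the head of \<open>c\<close>. Around the arrowhead
  of \<open>e\<close> the word \<open>g e f\<close> is the conjugate of \<open>e\<close> in the Wirtinger presentation.
\<close>

definition reroute :: "bool \<Rightarrow> nat \<Rightarrow> nat \<Rightarrow> nat \<Rightarrow> nat \<Rightarrow> nat endpoint \<Rightarrow> nat endpoint list" where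
  "reroute t c e f g x =
     (if x = Tail c then (if t then [Tail f, Tail c, Tail g] else [Tail g, Tail c, Tail f])
      else if x = Head e then [Head g, Head e, Head f]
      else if x = Head c then [Tail e] else if x = Tail e then [Head c] else [x])"

context
  fixes D c e f g
  assumes D: "gauss_diagram D" and ce: "c \<in> chords D" "e \<in> chords D" "c \<noteq> e"
    and fg: "f \<notin> chords D" "g \<notin> chords D" "f \<noteq> g"
begin

lemma fresh_endpoints:
  "Tail f \<notin> endpoints D" "Head f \<notin> endpoints D" "Tail g \<notin> endpoints D" "Head g \<notin> endpoints D"
  using fg chords_iff_Head[OF D] chords_iff_Tail[OF D] by blast+

lemma old_endpoints:
  "Tail c \<in> endpoints D" "Head c \<in> endpoints D" "Tail e \<in> endpoints D" "Head e \<in> endpoints D"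
  using ce chords_iff_Head[OF D] chords_iff_Tail[OF D] by blast+

lemma endpoints_finger:
  "endpoints (expand (finger t c e f g) p D) = endpoints D \<union> {Tail f, Head f, Tail g, Head g}"
proof -
  have "(\<Union>x\<in>endpoints D. set (finger t c e f g x)) =
      (\<Union>x\<in>endpoints D - {Tail c, Head e}. {x}) \<union> {Tail c, Tail f, Tail g} \<union> {Head g, Head f, Head e}"
    using old_endpoints by (auto simp: finger_def split: if_splits)
  then show ?thesis
    using old_endpoints by (auto simp: endpoints_expand)
qed

lemma endpoints_reroute:
  "endpoints (expand (reroute t c e f g) p D) = endpoints D \<union> {Tail f, Head f, Tail g, Head g}"
proof -
  have "(\<Union>x\<in>endpoints D. set (reroute t c e f g x)) =
      (\<Union>x\<in>endpoints D - {Tail c, Head e, Head c, Tail e}. {x})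
      \<union> {Tail c, Tail f, Tail g} \<union> {Head g, Head f, Head e} \<union> {Head c, Tail e}"
    using old_endpoints ce by (auto simp: reroute_def split: if_splits)
  then show ?thesis
    using old_endpoints by (auto simp: endpoints_expand)
qed

lemma gauss_diagram_finger: "gauss_diagram (expand (finger t c e f g) p D)"
proof -
  have "distinct (concat (circles (expand (finger t c e f g) p D)))"
    using D fg fresh_endpoints old_endpoints
    by (intro distinct_expand) (auto simp: finger_def)
  then show ?thesis
    using D by (auto simp: gauss_diagram_def endpoints_finger)
qed

lemma gauss_diagram_reroute: "gauss_diagram (expand (reroute t c e f g) p D)"
proof -
  have "distinct (concat (circles (expand (reroute t c e f g) p D)))"
    using D fg ce fresh_endpoints old_endpoints
    by (intro distinct_expand) (auto simp: reroute_def)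
  then show ?thesis
    using D by (auto simp: gauss_diagram_def endpoints_reroute)
qed

lemma delete_finger: "delete_chords {f, g} (expand (finger t c e f g) p D) = Gauss_Code (circles D) p"
proof -
  have "filter (\<lambda>x. chord x \<notin> {f, g}) (finger t c e f g x) = [x]" if "x \<in> endpoints D" for x
  proof -
    have "chord x \<in> chords D"
      using that by (simp add: chords_def)
    then have "chord x \<noteq> f" "chord x \<noteq> g"
      using fg by auto
    then show ?thesis
      by (auto simp: finger_def)
  qed
  then have "filter (\<lambda>x. chord x \<notin> {f, g}) (concat (map (finger t c e f g) w)) = w"
    if "set w \<subseteq> endpoints D" for w
    using that by (induction w) auto
  then show ?thesis
    using circle_subset_endpoints by (auto simp del: insert_iff simp: delete_chords_def circles_expand intro!: map_idI)
qed

lemma transpose_finger: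
  "map_code (transpose (Tail c) (Tail f) \<circ> transpose (Head c) (Tail e) \<circ> transpose (Head f) (Head e))
     (expand (finger t c e f g) p D) = expand (reroute t c e f g) p D"
proof -
  let ?\<tau> = "transpose (Tail c) (Tail f) \<circ> transpose (Head c) (Tail e) \<circ> transpose (Head f) (Head e)"
  have ne: "f \<noteq> c" "f \<noteq> e" "g \<noteq> c" "g \<noteq> e"
    using fg ce by auto
  have "map ?\<tau> (finger t c e f g x) = reroute t c e f g x" if "x \<in> endpoints D" for x
  proof -
    have "x \<noteq> Tail f" "x \<noteq> Head f" "x \<noteq> Tail g" "x \<noteq> Head g"
      using that fresh_endpoints by auto
    then show ?thesis
      using ne fg(3) ce(3) by (auto simp: finger_def reroute_def transpose_def)
  qed
  then have "map ?\<tau> (concat (map (finger t c e f g) w)) = concat (map (reroute t c e f g) w)"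
    if "set w \<subseteq> endpoints D" for w
    using that by (induction w) auto
  then show ?thesis
    using circle_subset_endpoints by (auto simp: map_code_def expand_def)
qed

text \<open>
  In the third move the top arc contains the tails of \<open>c\<close> and \<open>f\<close>, the middle arc the head of \<open>c\<close>
  and the tail of \<open>e\<close>, and the bottom arc the heads of \<open>f\<close> and \<open>e\<close>. The order on the middle arc
  and the signs of \<open>c\<close> and \<open>e\<close> are given, and the order on the bottom arc is that of a finger. The
  sign of \<open>f\<close> and the order on the top arc are free, and each of the two conditions for a planar
  triangle determines one of them.
\<close>

lemma gauss_equiv_reroute:
  assumes m: "met_in_order D m (Head c) (Tail e)"
  shows "\<exists>t p. (D, expand (reroute t c e f g) p D) \<in> gauss_equiv"
proof -
  \<comment> \<open>\<open>s\<close> is the sign of \<open>f\<close>; the values solve the conditions of \<open>R3\<close> with \<open>u = True\<close>.\<close>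
  define s where "s = (positive D c = m)"
  define t where "t = ((s = positive D e) = m)"
  define p where "p = (positive D)(f := s, g := \<not> s)"
  define D0 where "D0 = Gauss_Code (circles D) p"
  define D1 where "D1 = expand (finger t c e f g) p D"
  define D2 where "D2 = expand (reroute t c e f g) p D"
  have ne: "f \<noteq> c" "f \<noteq> e" "g \<noteq> c" "g \<noteq> e"
    using fg ce by auto
  have p: "p c = positive D c" "p e = positive D e" "p f = s" "p g = (\<not> s)"
    using ne fg by (auto simp: p_def)
  have diagrams: "gauss_diagram D0" "gauss_diagram D1" "gauss_diagram D2"
    using D gauss_diagram_finger gauss_diagram_reroute
    by (auto simp: D0_def D1_def D2_def gauss_diagram_def endpoints_def)
  have chords: "{c, e, f, g} \<subseteq> chords D1"
    using diagrams(2) old_endpoints by (auto simp: chords_iff_Tail D1_def endpoints_finger)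
  \<comment> \<open>Signs of numbers that label no chord are part of the code, so they are adjusted first.\<close>
  have "gauss_iso D D0"
    unfolding gauss_iso_def D0_def
  proof (intro exI[of _ id] conjI ballI)
    show "positive (Gauss_Code (circles D) p) (id d) = positive D d" if "d \<in> chords D" for d
      using that fg by (auto simp: p_def)
    have "rel_mset (\<lambda>w w'. \<exists>n. w' = rotate n (map (map_endpoint id) w)) M M" for M
      by (rule multiset.rel_refl) (auto simp: endpoint.map_id0 intro: exI[of _ 0])
    then show "rel_mset (\<lambda>w w'. \<exists>n. w' = rotate n (map (map_endpoint id) w))
        (mset (circles D)) (mset (circles (Gauss_Code (circles D) p)))"
      by simp
  qed simp
  moreover have "reidemeister D1 D0"
  proof -
    have "neighbours D1 (Tail f) (Tail g)"
    proof (cases t)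
      case True
      then have "finger t c e f g (Tail c) = [Tail c] @ Tail f # Tail g # []"
        by (simp add: finger_def)
      then show ?thesis
        unfolding neighbours_def D1_def
        using directly_after_within_expand[OF old_endpoints(1)] by blast
    next
      case False
      then have "finger t c e f g (Tail c) = [] @ Tail g # Tail f # [Tail c]"
        by (simp add: finger_def)
      then show ?thesis
        unfolding neighbours_def D1_def
        using directly_after_within_expand[OF old_endpoints(1)] by blast
    qed
    moreover have "finger t c e f g (Head e) = [] @ Head g # Head f # [Head e]"
      by (simp add: finger_def)
    then have "neighbours D1 (Head f) (Head g)"
      unfolding neighbours_def D1_def
      using directly_after_within_expand[OF old_endpoints(4)] by blast
    ultimately have "reidemeister D1 (delete_chords {f, g} D1)"
      using chords fg(3) p by (intro R2) (auto simp: D1_def)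
    then show ?thesis
      by (simp add: D0_def D1_def delete_finger)
  qed
  moreover have "reidemeister D1 D2"
  proof -
    have "met_in_order D1 t (Tail c) (Tail f)"
    proof (cases t)
      case True
      then have eq: "finger t c e f g (Tail c) = [] @ Tail c # Tail f # [Tail g]"
        by (simp add: finger_def)
      then show ?thesis
        using True directly_after_within_expand[of "Tail c" D "finger t c e f g", OF old_endpoints(1) eq]
        by (simp add: met_in_order_def D1_def)
    next
      case False
      then have eq: "finger t c e f g (Tail c) = [Tail g] @ Tail f # Tail c # []"
        by (simp add: finger_def)
      then show ?thesis
        using False directly_after_within_expand[of "Tail c" D "finger t c e f g", OF old_endpoints(1) eq]
        by (simp add: met_in_order_def D1_def)
    qed
    moreover have "met_in_order D1 m (Head c) (Tail e)"
    proof -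
      have "finger t c e f g (Head c) = [] @ [Head c]" "finger t c e f g (Head c) = Head c # []"
        "finger t c e f g (Tail e) = [] @ [Tail e]" "finger t c e f g (Tail e) = Tail e # []"
        using ce by (auto simp: finger_def)
      then show ?thesis
        using m directly_after_expand[of D "Head c" "Tail e"] directly_after_expand[of D "Tail e" "Head c"]
        unfolding met_in_order_def D1_def by (metis endpoint.distinct(1))
    qed
    moreover have "met_in_order D1 True (Head f) (Head e)"
    proof -
      have eq: "finger t c e f g (Head e) = [Head g] @ Head f # Head e # []"
        by (simp add: finger_def)
      then show ?thesis
        using directly_after_within_expand[of "Head e" D "finger t c e f g", OF old_endpoints(4) eq]
        by (simp add: met_in_order_def D1_def)
    qed
    ultimately have "reidemeister D1 (map_code (transpose (Tail c) (Tail f) \<circ>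
        transpose (Head c) (Tail e) \<circ> transpose (Head f) (Head e)) D1)"
    proof (rule R3[rotated 2])
      show "distinct [c, f, e]" "{c, f, e} \<subseteq> chords D1"
        using ne ce chords by auto
      show "(positive D1 c = positive D1 f) = (m = True)" "(positive D1 f = positive D1 e) = (t = m)"
        by (auto simp: D1_def p s_def t_def)
    qed
    then show ?thesis
      by (simp only: D1_def D2_def transpose_finger)
  qed
  ultimately have "equivclp gauss_step D D0" "equivclp gauss_step D0 D1" "equivclp gauss_step D1 D2"
    using D diagrams unfolding gauss_step_def
    by (blast intro: r_into_equivclp equivclp_sym[OF r_into_equivclp])+
  then have "(D, D2) \<in> gauss_equiv"
    using D diagrams unfolding gauss_equiv_def by (blast intro: equivclp_trans)
  then show ?thesis
    unfolding D2_def by blast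
qed

end

section \<open>Levels\<close>

text \<open>
  Here \<open>i x\<close> and \<open>e x\<close> are labels of the gaps before and after \<open>x\<close>. The word leads from a gap labelled
  \<open>a\<close> to one labelled \<open>b\<close> if neighbouring endpoints agree on the gap between them. Unlike the
  relation of being next to each other, this is compatible with concatenation and substitution.
\<close>

fun traverses :: "('a \<Rightarrow> 'b) \<Rightarrow> ('a \<Rightarrow> 'b) \<Rightarrow> 'b \<Rightarrow> 'a list \<Rightarrow> 'b \<Rightarrow> bool" where
  "traverses i e a [] b \<longleftrightarrow> a = b"
| "traverses i e a (x # xs) b \<longleftrightarrow> i x = a \<and> traverses i e (e x) xs b"

lemma traverses_append:
  "traverses i e a (xs @ ys) b \<longleftrightarrow> (\<exists>c. traverses i e a xs c \<and> traverses i e c ys b)"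
  by (induction xs arbitrary: a) auto

lemma traverses_concat_map:
  assumes "traverses i e a xs b"
    and "\<And>x. x \<in> set xs \<Longrightarrow> traverses i' e' (i x) (\<phi> x) (e x)"
  shows "traverses i' e' a (concat (map \<phi> xs)) b"
  using assms by (induction xs arbitrary: a) (auto simp: traverses_append)

definition round_trip :: "('a \<Rightarrow> 'b) \<Rightarrow> ('a \<Rightarrow> 'b) \<Rightarrow> 'a list \<Rightarrow> bool" where
  "round_trip i e w \<longleftrightarrow> (\<exists>a. traverses i e a w a)"

lemma round_trip_rotate: "round_trip i e (u @ v) \<longleftrightarrow> round_trip i e (v @ u)"
  by (auto simp: round_trip_def traverses_append)

lemma traverses_Cons_iff_nth:
  "traverses i e a (x # xs) b \<longleftrightarrow>
     i x = a \<and> (\<forall>j<length xs. e ((x # xs) ! j) = i (xs ! j)) \<and> e (last (x # xs)) = b"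
  by (induction xs arbitrary: a x) (auto simp: All_less_Suc2)

lemma round_trip_iff_nth:
  "round_trip i e w \<longleftrightarrow> (\<forall>j<length w. e (w ! j) = i (w ! (Suc j mod length w)))"
proof (cases w)
  case (Cons x xs)
  have "e ((x # xs) ! length xs) = e (last (x # xs))"
    by (simp add: last_conv_nth)
  then show ?thesis
    unfolding round_trip_def Cons traverses_Cons_iff_nth by (auto simp: All_less_Suc)
qed (simp add: round_trip_def)

lemma directly_after_levels_iff_round_trip:
  "(\<forall>x y. directly_after D x y \<longrightarrow> e x = i y) \<longleftrightarrow> (\<forall>w\<in>set (circles D). round_trip i e w)"
  unfolding round_trip_iff_nth directly_after_def by blast

text \<open>
  A levelling labels the gaps of all circles: both gaps at the tail of \<open>c\<close> by \<open>T c\<close>, and the gaps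
  before and after the head of \<open>c\<close> by \<open>P c\<close> and \<open>Q c\<close>. By \<open>step\<close> the label is constant on strands, so
  \<open>Q b\<close> is the level of \<open>Arc b\<close>. Circles without arrowheads, which are always seeds, have level 0, the
  levels \<open>1, \<dots>, k - 1\<close> are those of the other seeds, and \<open>reached\<close> says that the strand of level \<open>i\<close>
  in \<open>{k..<n}\<close> was coloured across the arrowhead of a chord with its tail on a lower level. Strands of level
  at least \<open>n\<close> carry no tails and need not be coloured at all; there labels may be repeated.
\<close>

locale leveling =
  fixes D T P Q and k n :: nat
  assumes D: "gauss_diagram D"
    and step: "directly_after D x y \<Longrightarrow> case_endpoint T Q x = (case_endpoint T P y :: nat)"
    and tail_less: "c \<in> chords D \<Longrightarrow> T c < n"
    and reached: "k \<le> i \<Longrightarrow> i < n \<Longrightarrow>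
      \<exists>c\<in>chords D. T c < i \<and> (Q c = i \<and> P c < i \<or> P c = i \<and> Q c < i)"
    and arc_pos: "b \<in> chords D \<Longrightarrow> 0 < Q b"
    and arc_inj: "b \<in> chords D \<Longrightarrow> b' \<in> chords D \<Longrightarrow> Q b = Q b' \<Longrightarrow> Q b < n \<Longrightarrow> b = b'"
    and headless: "w \<in> set (circles D) \<Longrightarrow> Tail c \<in> set w \<Longrightarrow> (\<And>b. Head b \<notin> set w) \<Longrightarrow> T c = 0"
begin

lemma along_arc_level: "along_arc D b x \<Longrightarrow> case_endpoint T P x = Q b"
proof (induction rule: along_arc.induct)
  case (first x)
  then show ?case using step[of "Head b" x] by simp
next
  case (pass_tail c x)
  then show ?case using step[of "Tail c" x] by simp
qed

text \<open>
  Walking round the circle of the tail, the level \<open>i\<close> has to be entered through an arrowhead: the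
  circle has one, as \<open>i\<close> is not 0, and there is no other way to change the level.
\<close>

lemma ex_tail_after_head:
  assumes e: "e \<in> chords D" "T e = i" "0 < i"
  shows "\<exists>b d. directly_after D (Head b) (Tail d) \<and> Q b = i \<and> T d = i"
proof (rule ccontr)
  assume none: "\<not> ?thesis"
  obtain w where w: "w \<in> set (circles D)" "Tail e \<in> set w"
    using e chords_iff_Tail[OF D] circle_of_endpoint by blast
  then obtain b where b: "Head b \<in> set w"
    using headless[OF w] e by auto
  define S where "S = case_endpoint (\<lambda>d. T d \<noteq> i) (\<lambda>_. True)"
  have "S y" if "directly_after D x y" "S x" for x y
    using that none step[OF that(1)] by (cases x; cases y) (auto simp: S_def)
  then have "S (Tail e)"
    using circle_propagate[OF w(1) b _ w(2), of S] by (auto simp: S_def)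
  then show False
    using e by (simp add: S_def)
qed

text \<open>
  As the levels of arcs are distinct, the arrowhead found by \<open>ex_tail_after_head\<close> is that of \<open>c\<close> if the
  arc of level \<open>i\<close> begins at \<open>c\<close>. If it ends there, then the endpoint before the head of \<open>c\<close> is a tail:
  otherwise that endpoint would be the arrowhead where the arc begins, and the arc would carry no
  tails at all.
\<close>

lemma ex_tail_next_to_head:
  assumes e: "e \<in> chords D" "T e = i" "0 < i" "i < n"
    and c: "c \<in> chords D" "Q c = i \<or> P c = i"
  shows "\<exists>m d. d \<in> chords D \<and> T d = i \<and> met_in_order D m (Head c) (Tail d)"
proof -
  obtain b d where bd: "directly_after D (Head b) (Tail d)" "Q b = i" "T d = i"
    using ex_tail_after_head[OF e(1-3)] by blast
  then have chords: "b \<in> chords D" "d \<in> chords D"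
    using directly_after_endpoints[OF bd(1)] chords_iff_Head[OF D] chords_iff_Tail[OF D] by auto
  show ?thesis
  proof (cases "Q c = i")
    case True
    then have "c = b"
      using arc_inj[of c b] bd chords c e by simp
    then show ?thesis
      using bd chords by (intro exI[of _ True] exI[of _ d]) (simp add: met_in_order_def)
  next
    case False
    obtain x where x: "directly_after D x (Head c)"
      using c chords_iff_Head[OF D] ex_directly_after by blast
    have level: "case_endpoint T Q x = i"
      using False c step[OF x] by simp
    show ?thesis
    proof (cases x)
      case (Tail d')
      then have "d' \<in> chords D" "T d' = i"
        using level directly_after_endpoints[OF x] chords_iff_Tail[OF D] by auto
      then show ?thesis
        using x Tail by (intro exI[of _ False] exI[of _ d']) (simp add: met_in_order_def)
    next
      case (Head b')
      then have "b' \<in> chords D" "Q b' = i"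
        using level directly_after_endpoints[OF x] chords_iff_Head[OF D] by auto
      then have "b' = b"
        using arc_inj[of b' b] bd chords e by simp
      then show ?thesis
        using directly_after_unique_right[OF D x] Head bd(1) by blast
    qed
  qed
qed

end

definition headless_circles :: "gauss_code \<Rightarrow> nat set" where
  "headless_circles D = {i. i < length (circles D) \<and> (\<forall>b. Head b \<notin> set (circles D ! i))}"

text \<open>
  If all tails lie below level \<open>k\<close>, then so do the overbridges, and arcs are determined by their
  positive levels.
\<close>

lemma vb_diagram_le_levels:
  assumes "leveling D T P Q k k"
  shows "vb_diagram D \<le> card (headless_circles D) + (k - 1)"
proof -
  interpret leveling D T P Q k k by fact
  define B where "B = {b \<in> chords D. Q b < k}"
  have "overbridges D \<subseteq> Circle ` headless_circles D \<union> Arc ` B"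
  proof
    fix s
    assume "s \<in> overbridges D"
    then obtain c where s: "s \<in> strands D" "c \<in> chords D" "tail_on_strand D c s"
      by (auto simp: overbridges_def)
    show "s \<in> Circle ` headless_circles D \<union> Arc ` B"
    proof (cases s)
      case (Arc b)
      then have "along_arc D b (Tail c)"
        using s by simp
      then have "Q b = T c"
        using along_arc_level by fastforce
      then show ?thesis
        using s Arc tail_less by (auto simp: B_def strands_def)
    next
      case (Circle i)
      then show ?thesis
        using s by (auto simp: strands_def headless_circles_def)
    qed
  qed
  moreover have fin: "finite (headless_circles D)" "finite B"
    by (auto simp: headless_circles_def B_def finite_chords)
  ultimately have "vb_diagram D \<le> card (Circle ` headless_circles D \<union> Arc ` B)"
    unfolding vb_diagram_def by (intro card_mono) auto
  also have "\<dots> \<le> card (headless_circles D) + card B"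
    using fin by (meson add_mono card_Un_le card_image_le le_trans)
  also have "card B \<le> card {1..<k}"
  proof (rule card_inj_on_le)
    show "inj_on Q B"
      using arc_inj by (auto simp: inj_on_def B_def)
    show "Q ` B \<subseteq> {1..<k}"
      using arc_pos by (auto simp: B_def Suc_le_eq)
  qed simp
  finally show ?thesis by simp
qed

text \<open>
  One rerouting step. The top level is \<open>n\<close>; the chord \<open>c\<close> is the one by which it was reached, and the
  tail of \<open>e\<close> has this level and is next to the arrowhead of \<open>c\<close>.
\<close>

context
  fixes D T P Q k n c e f g m
  assumes lev: "leveling D T P Q k (Suc n)"
    and e: "e \<in> chords D" "T e = n" and c: "c \<in> chords D" "T c < n"
    and sides: "Q c = n \<and> P c < n \<or> P c = n \<and> Q c < n"
    and m: "met_in_order D m (Head c) (Tail e)"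
    and fg: "f \<notin> chords D" "g \<notin> chords D" "f \<noteq> g"
begin

interpretation leveling D T P Q k "Suc n"
  by (fact lev)

lemma crossing_distinct: "c \<noteq> e"
  using c e by auto

lemma levels_at_crossing: "if m then Q c = n \<and> P c < n else P c = n \<and> Q c < n"
  using m sides step[of "Head c" "Tail e"] step[of "Tail e" "Head c"] e
  by (auto simp: met_in_order_def split: if_splits)

lemma fresh_distinct: "f \<noteq> c" "f \<noteq> e" "g \<noteq> c" "g \<noteq> e"
  using fg c e by auto

lemma crossing_circle:
  obtains u v r where "u @ v \<in> set (circles D)"
    "v @ u = (if m then [Head c, Tail e] else [Tail e, Head c]) @ r"
    "Head c \<notin> set r" "Tail e \<notin> set r"
proof -
  have "\<exists>u v r. u @ v \<in> set (circles D) \<and> v @ u = (if m then [Head c, Tail e] else [Tail e, Head c]) @ r"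
  proof (cases m)
    case True
    then have "directly_after D (Head c) (Tail e)"
      using m by (simp add: met_in_order_def)
    then show ?thesis
      using True by (elim directly_afterE) auto
  next
    case False
    then have "directly_after D (Tail e) (Head c)"
      using m by (simp add: met_in_order_def)
    then show ?thesis
      using False by (elim directly_afterE) auto
  qed
  then obtain u v r where uv: "u @ v \<in> set (circles D)"
    "v @ u = (if m then [Head c, Tail e] else [Tail e, Head c]) @ r"
    by blast
  moreover have "distinct (v @ u)"
    using distinct_circle[OF D uv(1)] by auto
  ultimately show thesis
    using that[of u v r] by (auto split: if_splits)
qed

lemma Head_c_iff_Tail_e:
  assumes "w \<in> set (circles D)"
  shows "Head c \<in> set w \<longleftrightarrow> Tail e \<in> set w"
proof -
  obtain u v r where uv: "u @ v \<in> set (circles D)"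
    "v @ u = (if m then [Head c, Tail e] else [Tail e, Head c]) @ r"
    using crossing_circle .
  then have "set (v @ u) = {Head c, Tail e} \<union> set r"
    by (auto split: if_splits)
  then have "Head c \<in> set (u @ v)" "Tail e \<in> set (u @ v)"
    by auto
  then show ?thesis
    using circle_unique[OF D assms uv(1)] by blast
qed

abbreviation (input) rerouted :: "bool \<Rightarrow> nat endpoint list \<Rightarrow> nat endpoint list" where
  "rerouted t w \<equiv> concat (map (reroute t c e f g) w)"

lemma rerouted_has_Head:
  assumes w: "w \<in> set (circles D)"
  shows "(\<exists>b. Head b \<in> set (rerouted t w)) \<longleftrightarrow> (\<exists>b. Head b \<in> set w)"
proof
  assume "\<exists>b. Head b \<in> set (rerouted t w)"
  then obtain b x where "x \<in> set w" "Head b \<in> set (reroute t c e f g x)"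
    by auto
  then show "\<exists>b. Head b \<in> set w"
    using Head_c_iff_Tail_e[OF w] by (auto simp: reroute_def split: if_splits)
next
  assume "\<exists>b. Head b \<in> set w"
  then obtain b where b: "Head b \<in> set w" by blast
  show "\<exists>b. Head b \<in> set (rerouted t w)"
  proof (cases "b = c")
    case True
    then have "Tail e \<in> set w" "Head c \<in> set (reroute t c e f g (Tail e))"
      using b Head_c_iff_Tail_e[OF w] crossing_distinct by (auto simp: reroute_def)
    then show ?thesis by auto
  next
    case False
    then have "Head b \<in> set (reroute t c e f g (Head b))"
      by (simp add: reroute_def)
    then show ?thesis using b by auto
  qed
qed

lemma rerouted_has_Tail:
  assumes w: "w \<in> set (circles D)" and "\<exists>d. Tail d \<in> set w"
  shows "\<exists>d. Tail d \<in> set (rerouted t w)"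
proof -
  obtain d where d: "Tail d \<in> set w" using assms by blast
  show ?thesis
  proof (cases "d = e")
    case True
    then have "Head c \<in> set w" "Tail e \<in> set (reroute t c e f g (Head c))"
      using d Head_c_iff_Tail_e[OF w] crossing_distinct by (auto simp: reroute_def)
    then show ?thesis by auto
  next
    case False
    then have "Tail d \<in> set (reroute t c e f g (Tail d))"
      by (simp add: reroute_def)
    then show ?thesis using d by auto
  qed
qed

lemma headless_circles_reroute:
  "headless_circles (expand (reroute t c e f g) p D) = headless_circles D"
proof -
  have "(\<forall>b. Head b \<notin> set (rerouted t (circles D ! i))) \<longleftrightarrow> (\<forall>b. Head b \<notin> set (circles D ! i))"
    if "i < length (circles D)" for i
    using rerouted_has_Head[OF nth_mem[OF that], of t] by blast
  then show ?thesis
    by (simp add: headless_circles_def circles_expand del: set_concat cong: conj_cong)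
qed

lemma tail_on_each_circle_reroute:
  "tail_on_each_circle D \<Longrightarrow> tail_on_each_circle (expand (reroute t c e f g) p D)"
  using rerouted_has_Tail[of _ t] by (simp add: tail_on_each_circle_def circles_expand del: set_concat)

lemma chords_reroute: "chords (expand (reroute t c e f g) p D) = chords D \<union> {f, g}"
  using endpoints_reroute[OF D c(1) e(1) crossing_distinct fg]
    gauss_diagram_reroute[OF D c(1) e(1) crossing_distinct fg]
    chords_iff_Tail[OF D] by (auto simp: chords_iff_Tail)

text \<open>
  The tail of \<open>e\<close> gets the level on the far side of the arrowhead of \<open>c\<close>, whose own two labels do
  not change. The new tails have the level of the tail of \<open>c\<close>. The two new strands between the heads
  of \<open>g\<close>, \<open>e\<close>, \<open>f\<close> carry no tails; they share the level \<open>Suc n\<close>, which is outside the range where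
  levels of arcs have to differ. The arc that began at the head of \<open>e\<close> begins at that of \<open>f\<close> now.
\<close>

definition rerouted_tail_level where
  "rerouted_tail_level = T(e := if m then P c else Q c, f := T c, g := T c)"

definition rerouted_entry_level where
  "rerouted_entry_level = P(g := P e, e := Suc n, f := Suc n)"

definition rerouted_exit_level where
  "rerouted_exit_level = Q(g := Suc n, e := Suc n, f := Q e)"

abbreviation (input) rerouted_entry :: "nat endpoint \<Rightarrow> nat" where
  "rerouted_entry \<equiv> case_endpoint rerouted_tail_level rerouted_entry_level"

abbreviation (input) rerouted_exit :: "nat endpoint \<Rightarrow> nat" where
  "rerouted_exit \<equiv> case_endpoint rerouted_tail_level rerouted_exit_level"

text \<open>
  Apart from the two endpoints that change places, a substituted word connects the same levels as the
  endpoint that it replaces.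
\<close>

lemma traverses_reroute:
  assumes "x \<in> endpoints D" "x \<noteq> Head c" "x \<noteq> Tail e"
  shows "traverses rerouted_entry rerouted_exit
    (case_endpoint T P x) (reroute t c e f g x) (case_endpoint T Q x)"
proof -
  have "x \<notin> {Tail f, Head f, Tail g, Head g}"
    using assms fresh_endpoints[OF D c(1) e(1) crossing_distinct fg] by auto
  then show ?thesis
    using assms fresh_distinct fg crossing_distinct
    by (cases x) (auto simp: reroute_def rerouted_tail_level_def rerouted_entry_level_def
        rerouted_exit_level_def)
qed

lemma round_trip_reroute:
  assumes w: "w \<in> set (circles D)"
  shows "round_trip rerouted_entry rerouted_exit (rerouted t w)"
proof -
  have trip: "round_trip (case_endpoint T P) (case_endpoint T Q) w"
    using w step directly_after_levels_iff_round_trip by blast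
  show ?thesis
  proof (cases "Head c \<in> set w")
    case False
    obtain a where a: "traverses (case_endpoint T P) (case_endpoint T Q) a w a"
      using trip by (auto simp: round_trip_def)
    have "traverses rerouted_entry rerouted_exit a (rerouted t w) a"
    proof (rule traverses_concat_map[OF a])
      fix x
      assume "x \<in> set w"
      moreover from this have "x \<noteq> Head c" "x \<noteq> Tail e"
        using False Head_c_iff_Tail_e[OF w] by auto
      ultimately show "traverses rerouted_entry rerouted_exit
          (case_endpoint T P x) (reroute t c e f g x) (case_endpoint T Q x)"
        using traverses_reroute circle_subset_endpoints[OF w] by blast
    qed
    then show ?thesis
      by (auto simp: round_trip_def)
  next
    case True
    obtain u v r where uv: "u @ v \<in> set (circles D)"
      "v @ u = (if m then [Head c, Tail e] else [Tail e, Head c]) @ r"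
      "Head c \<notin> set r" "Tail e \<notin> set r"
      using crossing_circle .
    have "Head c \<in> set (v @ u)"
      unfolding uv(2) by simp
    then have uvw: "u @ v = w"
      using circle_unique[OF D uv(1) w] True by auto
    have r: "x \<in> endpoints D" "x \<noteq> Head c" "x \<noteq> Tail e" if "x \<in> set r" for x
    proof -
      have "set r \<subseteq> set (v @ u)"
        unfolding uv(2) by auto
      then show "x \<in> endpoints D"
        using that circle_subset_endpoints[OF uv(1)] by auto
    qed (use that uv in auto)
    have "round_trip (case_endpoint T P) (case_endpoint T Q) (v @ u)"
      using trip uvw round_trip_rotate by metis
    then have trav: "traverses (case_endpoint T P) (case_endpoint T Q)
        (if m then T e else Q c) r (if m then P c else T e)"
      unfolding uv(2) using e levels_at_crossing by (auto simp: round_trip_def split: if_splits)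
    have "traverses rerouted_entry rerouted_exit (Q c) (rerouted t r) (P c)"
    proof (rule traverses_concat_map)
      show "traverses (case_endpoint T P) (case_endpoint T Q) (Q c) r (P c)"
        using trav levels_at_crossing e by (auto split: if_splits)
    qed (use r traverses_reroute in blast)
    then have "round_trip rerouted_entry rerouted_exit (rerouted t (v @ u))"
      unfolding uv(2) using crossing_distinct fresh_distinct
      by (auto simp: round_trip_def reroute_def rerouted_tail_level_def
          rerouted_entry_level_def rerouted_exit_level_def)
    then show ?thesis
      unfolding uvw[symmetric] by (simp add: round_trip_rotate)
  qed
qed

text \<open>
  The chords by which the levels were reached keep their labels: the tail of such a chord is below
  level \<open>n\<close>, so the chord is not \<open>e\<close>.
\<close>

lemma leveling_reroute:
  "leveling (expand (reroute t c e f g) p D)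
     rerouted_tail_level rerouted_entry_level rerouted_exit_level k (Suc n)"
proof
  let ?D = "expand (reroute t c e f g) p D"
  show "gauss_diagram ?D"
    using gauss_diagram_reroute[OF D c(1) e(1) crossing_distinct fg] .
  show "rerouted_exit x = rerouted_entry y" if "directly_after ?D x y" for x y
  proof -
    have "\<forall>w\<in>set (circles ?D). round_trip rerouted_entry rerouted_exit w"
      using round_trip_reroute by (auto simp: circles_expand)
    then show ?thesis
      using that directly_after_levels_iff_round_trip by blast
  qed
  show "rerouted_tail_level d < Suc n" if "d \<in> chords ?D" for d
    using that tail_less[of d] c levels_at_crossing
    by (auto simp: chords_reroute rerouted_tail_level_def split: if_splits)
  show "\<exists>d\<in>chords ?D. rerouted_tail_level d < i \<and>
      (rerouted_exit_level d = i \<and> rerouted_entry_level d < i \<or>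
       rerouted_entry_level d = i \<and> rerouted_exit_level d < i)"
    if i: "k \<le> i" "i < Suc n" for i
  proof -
    obtain d where d: "d \<in> chords D" "T d < i" "Q d = i \<and> P d < i \<or> P d = i \<and> Q d < i"
      using reached[OF i] by blast
    then have "d \<noteq> e" "d \<noteq> f" "d \<noteq> g"
      using i e fg by auto
    then show ?thesis
      using d by (intro bexI[of _ d]) (auto simp: chords_reroute rerouted_tail_level_def
          rerouted_entry_level_def rerouted_exit_level_def)
  qed
  show "0 < rerouted_exit_level b" if "b \<in> chords ?D" for b
    using that arc_pos[of b] arc_pos[of e] e by (auto simp: chords_reroute rerouted_exit_level_def)
  show "b = b'" if "b \<in> chords ?D" "b' \<in> chords ?D"
    "rerouted_exit_level b = rerouted_exit_level b'" "rerouted_exit_level b < Suc n" for b b'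
  proof -
    \<comment> \<open>An arc of level at most \<open>n\<close> is an old one, and only the arc that began at \<open>e\<close> was renamed.\<close>
    define old where "old = id(f := e)"
    have old: "old a \<in> chords D \<and> rerouted_exit_level a = Q (old a) \<and> a \<noteq> e"
      if "a \<in> chords ?D" "rerouted_exit_level a < Suc n" for a
      using that e fresh_distinct fg by (auto simp: chords_reroute rerouted_exit_level_def old_def split: if_splits)
    have "old b = old b'"
      using old[of b] old[of b'] that by (intro arc_inj[of "old b" "old b'"]) simp_all
    then show ?thesis
      using old[of b] old[of b'] that by (auto simp: old_def split: if_splits)
  qed
  show "rerouted_tail_level d = 0" if w': "w' \<in> set (circles ?D)" "Tail d \<in> set w'" "\<And>b. Head b \<notin> set w'" for w' d
  proof -
    obtain w where w: "w \<in> set (circles D)" "w' = rerouted t w"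
      using w' by (auto simp: circles_expand)
    then have no_head: "Head b \<notin> set w" for b
      using rerouted_has_Head[OF w(1)] w'(3) by blast
    then have "Tail e \<notin> set w"
      using Head_c_iff_Tail_e[OF w(1)] by blast
    obtain x where x: "x \<in> set w" "Tail d \<in> set (reroute t c e f g x)"
      using w w' by auto
    obtain a where a: "x = Tail a"
      using no_head x by (cases x) auto
    then have "a \<noteq> e" "a \<noteq> f" "a \<noteq> g"
      using x \<open>Tail e \<notin> set w\<close> circle_subset_endpoints[OF w(1)]
        fresh_endpoints[OF D c(1) e(1) crossing_distinct fg] by auto
    moreover have "T a = 0"
      using headless[OF w(1)] x a no_head by blast
    ultimately show ?thesis
      using x a fresh_distinct by (auto simp: reroute_def rerouted_tail_level_def split: if_splits)
  qed
qed

lemma tails_at_top_reroute: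
  "{d \<in> chords (expand (reroute t c e f g) p D). rerouted_tail_level d = n} = {d \<in> chords D. T d = n} - {e}"
  using c fg fresh_distinct levels_at_crossing by (auto simp: chords_reroute rerouted_tail_level_def split: if_splits)

end

text \<open>
  Each rerouting removes one tail from the top level and adds none, so it can be repeated until the
  top level has no tails. Then the level can be dropped from the range.
\<close>

lemma lower_top_level:
  assumes "leveling D T P Q k (Suc n)" "0 < k" "k \<le> n" "tail_on_each_circle D"
  shows "\<exists>D' T' P' Q'. (D, D') \<in> gauss_equiv \<and> tail_on_each_circle D' \<and>
    headless_circles D' = headless_circles D \<and> leveling D' T' P' Q' k n"
  using assms
proof (induction "card {d \<in> chords D. T d = n}" arbitrary: D T P Q rule: less_induct)
  case less
  interpret leveling D T P Q k "Suc n"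
    by fact
  show ?case
  proof (cases "\<exists>e\<in>chords D. T e = n")
    case False
    then have less_n: "T d < n" if "d \<in> chords D" for d
      using that tail_less[of d] by force
    have "leveling D T P Q k n"
    proof
      fix i
      assume "k \<le> i" "i < n"
      then show "\<exists>c\<in>chords D. T c < i \<and> (Q c = i \<and> P c < i \<or> P c = i \<and> Q c < i)"
        using reached by simp
    qed (use D step less_n arc_pos arc_inj headless in auto)
    moreover have "(D, D) \<in> gauss_equiv"
      using D by (simp add: gauss_equiv_def)
    ultimately show ?thesis
      using less.prems(4) by blast
  next
    case True
    obtain c where c: "c \<in> chords D" "T c < n" "Q c = n \<and> P c < n \<or> P c = n \<and> Q c < n"
      using reached[of n] less.prems by auto
    obtain e' where "e' \<in> chords D" "T e' = n"
      using True by blast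
    then have "\<exists>m d. d \<in> chords D \<and> T d = n \<and> met_in_order D m (Head c) (Tail d)"
      using c less.prems(2,3) by (intro ex_tail_next_to_head[of e' n c]) auto
    then obtain m e where e: "e \<in> chords D" "T e = n" "met_in_order D m (Head c) (Tail e)"
      by blast
    obtain f where f: "f \<notin> chords D"
      using ex_new_if_finite[OF infinite_UNIV_nat finite_chords] by blast
    obtain g where g: "g \<notin> insert f (chords D)"
      using ex_new_if_finite[OF infinite_UNIV_nat] finite_chords finite_insert by metis
    have ne: "c \<noteq> e" "f \<noteq> g" "g \<notin> chords D"
      using c e g by auto
    obtain t p where equiv: "(D, expand (reroute t c e f g) p D) \<in> gauss_equiv"
      using gauss_equiv_reroute[OF D c(1) e(1) ne(1) f ne(3,2) e(3)] by blast
    let ?D = "expand (reroute t c e f g) p D"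
    note hyps = less.prems(1) e(1,2) c e(3) f ne(3,2)
    have "card {d \<in> chords ?D. rerouted_tail_level T P Q c e f g m d = n} < card {d \<in> chords D. T d = n}"
      unfolding tails_at_top_reroute[OF hyps]
      using e by (intro card_Diff1_less) (auto simp: finite_chords)
    then obtain D' T'' P'' Q'' where "(?D, D') \<in> gauss_equiv" "tail_on_each_circle D'"
      "headless_circles D' = headless_circles ?D" "leveling D' T'' P'' Q'' k n"
      using less.hyps[OF _ leveling_reroute[OF hyps] less.prems(2,3)
          tail_on_each_circle_reroute[OF hyps less.prems(4)]] by blast
    then show ?thesis
      using equiv headless_circles_reroute[OF hyps] equiv_gauss_equiv
      by (metis equivE transE)
  qed
qed

lemma lower_levels:
  assumes "leveling D T P Q k n" "0 < k" "k \<le> n" "tail_on_each_circle D"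
  shows "\<exists>D' T' P' Q'. (D, D') \<in> gauss_equiv \<and> tail_on_each_circle D' \<and>
    headless_circles D' = headless_circles D \<and> leveling D' T' P' Q' k k"
  using assms(3,1,4)
proof (induction n arbitrary: D T P Q rule: dec_induct)
  case base
  then have "(D, D) \<in> gauss_equiv"
    by (simp add: gauss_equiv_def leveling_def)
  then show ?case
    using base by blast
next
  case (step n)
  obtain D1 T1 P1 Q1 where 1: "(D, D1) \<in> gauss_equiv" "tail_on_each_circle D1"
    "headless_circles D1 = headless_circles D" "leveling D1 T1 P1 Q1 k n"
    using lower_top_level[OF step.prems(1) assms(2) step.hyps(1) step.prems(2)] by blast
  then obtain D2 T2 P2 Q2 where "(D1, D2) \<in> gauss_equiv" "tail_on_each_circle D2"
    "headless_circles D2 = headless_circles D1" "leveling D2 T2 P2 Q2 k k"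
    using step.IH by blast
  then show ?case
    using 1 equiv_gauss_equiv by (metis equivE transE)
qed

section \<open>Levels from a colouring\<close>

definition colored_arcs :: "coloring \<Rightarrow> nat set" where
  "colored_arcs col = {b. Arc b \<in> dom col}"

text \<open>
  The arc of number \<open>i\<close> can be coloured by a move as soon as all smaller numbers are coloured.
  Circles without arrowheads count as smaller, as they can only be seeds.
\<close>

definition earned :: "gauss_code \<Rightarrow> coloring \<Rightarrow> (nat \<Rightarrow> nat) \<Rightarrow> nat \<Rightarrow> bool" where
  "earned D col N i \<longleftrightarrow>
     (\<exists>c\<in>colored_arcs col. \<exists>b\<in>colored_arcs col. along_arc D b (Head c) \<and>
        (N c = i \<and> N b < i \<or> N b = i \<and> N c < i) \<and>
        (\<exists>s\<in>dom col. tail_on_strand D c s \<and> (\<forall>a. s = Arc a \<longrightarrow> N a < i)))"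

lemma earnedI:
  assumes "c \<in> colored_arcs col" "b \<in> colored_arcs col" "along_arc D b (Head c)"
    and "N c = i \<and> N b < i \<or> N b = i \<and> N c < i"
    and "s \<in> dom col" "tail_on_strand D c s" "\<And>a. s = Arc a \<Longrightarrow> N a < i"
  shows "earned D col N i"
  using assms unfolding earned_def by blast

text \<open>
  The arcs among the seeds are numbered from 1, and each move gives the next number to the strand that
  it colours. Such a strand is an arc, because a move takes place at an arrowhead.
\<close>

lemma coloring_moves_number_arcs:
  assumes "(coloring_move D ^^ j) col col'" and dom: "dom col \<subseteq> strands D"
  defines "k \<equiv> Suc (card (colored_arcs col))"
  shows "dom col' \<subseteq> strands D \<and> (\<forall>i. Circle i \<in> dom col' \<longrightarrow> Circle i \<in> dom col) \<and>
    (\<exists>N. inj_on N (colored_arcs col') \<and> N ` colored_arcs col' \<subseteq> {1..<k + j} \<and>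
      (\<forall>i\<in>{k..<k + j}. earned D col' N i))"
  using assms(1)
proof (induction j arbitrary: col')
  case 0
  have "colored_arcs col \<subseteq> chords D"
    using dom by (auto simp: colored_arcs_def strands_def)
  then have "finite (colored_arcs col)"
    using finite_chords finite_subset by blast
  then obtain h where h: "bij_betw h (colored_arcs col) {0..<card (colored_arcs col)}"
    using ex_bij_betw_finite_nat by blast
  define N where "N = Suc \<circ> h"
  have "inj_on N (colored_arcs col)" "N ` colored_arcs col \<subseteq> {1..<k}"
    using h by (auto simp: N_def k_def bij_betw_def inj_on_def)
  then show ?case
    using 0 dom by (intro conjI exI[of _ N]) auto
next
  case (Suc j)
  obtain col1 where col1: "(coloring_move D ^^ j) col col1" "coloring_move D col1 col'"
    using Suc.prems by auto
  have dom1: "dom col1 \<subseteq> strands D" "\<And>i. Circle i \<in> dom col1 \<Longrightarrow> Circle i \<in> dom col"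
    using Suc.IH[OF col1(1)] by blast+
  obtain N where N: "inj_on N (colored_arcs col1)" "N ` colored_arcs col1 \<subseteq> {1..<k + j}"
    "\<forall>i\<in>{k..<k + j}. earned D col1 N i"
    using Suc.IH[OF col1(1)] by (elim conjE exE) (rule that)
  obtain c p q s where c: "c \<in> chords D" "s \<in> dom col1" "tail_on_strand D c s"
    and pq: "adjacent_at D c p q" "p \<in> dom col1" "q \<notin> dom col1" "col' = col1(q := col1 p)"
    using col1(2) unfolding coloring_move_def by blast
  obtain b where b: "b \<in> chords D" "along_arc D b (Head c)"
    "p = Arc b \<and> q = Arc c \<or> p = Arc c \<and> q = Arc b"
    using pq(1) unfolding adjacent_at_def by blast
  define a where "a = (if q = Arc c then c else b)"
  have q: "q = Arc a" "a \<in> chords D"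
    using b c by (auto simp: a_def)
  have dom': "dom col' = insert (Arc a) (dom col1)"
    using pq q by auto
  then have A': "colored_arcs col' = insert a (colored_arcs col1)"
    by (auto simp: colored_arcs_def)
  have a: "a \<notin> colored_arcs col1"
    using pq q by (simp add: colored_arcs_def)
  define N' where "N' = N(a := k + j)"
  have old: "N' d = N d" if "d \<in> colored_arcs col1" for d
    using that a by (auto simp: N'_def)
  have less: "N d < k + j" if "d \<in> colored_arcs col1" for d
    using that N(2) by auto
  have "dom col' \<subseteq> strands D"
    using dom' dom1 q by (auto simp: strands_def)
  moreover have "Circle i \<in> dom col" if "Circle i \<in> dom col'" for i
    using that dom' dom1 by auto
  moreover have "inj_on N' (colored_arcs col')"
    unfolding A' using N(1) a less old by (force simp: inj_on_def N'_def)
  moreover have "N' ` colored_arcs col' \<subseteq> {1..<k + Suc j}"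
    using N(2) by (fastforce simp: A' N'_def k_def)
  moreover have "earned D col' N' i" if i: "i \<in> {k..<k + Suc j}" for i
  proof (cases "i < k + j")
    case True
    then have "earned D col1 N i"
      using N(3) i by simp
    then obtain d s b' where d: "s \<in> dom col1" "tail_on_strand D d s"
        "\<forall>b. s = Arc b \<longrightarrow> N b < i" "d \<in> colored_arcs col1" "b' \<in> colored_arcs col1" "along_arc D b' (Head d)"
        "N d = i \<and> N b' < i \<or> N b' = i \<and> N d < i"
      unfolding earned_def by blast
    have "N' a' < i" if s: "s = Arc a'" for a'
    proof -
      have "a' \<in> colored_arcs col1"
        using d(1) s by (simp add: colored_arcs_def)
      then show ?thesis
        using d(3) s old by simp
    qed
    moreover have "N' d = i \<and> N' b' < i \<or> N' b' = i \<and> N' d < i"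
      using d old by simp
    ultimately show ?thesis
      using d dom' A' by (intro earnedI[of d _ b' _ _ _ s]) simp_all
  next
    case False
    then have i: "i = k + j" using i by simp
    have below: "N' a' < i" if "Arc a' \<in> dom col1" for a'
    proof -
      have "a' \<in> colored_arcs col1"
        using that by (simp add: colored_arcs_def)
      then show ?thesis
        using old less i by simp
    qed
    then have "N' a' < i" if "s = Arc a'" for a'
      using c(2) that by simp
    moreover have "b \<in> colored_arcs col'" "c \<in> colored_arcs col'"
      using b(3) pq(2) q(1) unfolding colored_arcs_def dom' by auto
    moreover have "N' c = i \<and> N' b < i \<or> N' b = i \<and> N' c < i"
    proof -
      have "p = Arc b \<and> a = c \<or> p = Arc c \<and> a = b"
        using b(3) q(1) by auto
      moreover have "N' a = i"
        by (simp add: N'_def i)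
      moreover have "N' d < i" if "p = Arc d" for d
        using that pq(2) below by blast
      ultimately show ?thesis by blast
    qed
    ultimately show ?thesis
      using b c dom' by (intro earnedI[of c _ b _ _ _ s]) simp_all
  qed
  ultimately show ?case by blast
qed

text \<open>
  Each gap is labelled by the number of the arc that it belongs to. The numbers \<open>1, \<dots>, k - 1\<close>
  are those of the arcs among the seeds, and the other seeds are exactly the circles without arrowheads.
\<close>

lemma ex_leveling:
  assumes D: "gauss_diagram D" and "meridionally_colorable w D"
  shows "\<exists>T P Q k n. leveling D T P Q k n \<and> 0 < k \<and> k \<le> n \<and> card (headless_circles D) + (k - 1) = w"
proof -
  obtain col col' where col: "dom col \<subseteq> strands D" "card (dom col) = w"
    and moves: "(coloring_move D ^^ (card (strands D) - w)) col col'" and dom': "dom col' = strands D"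
    using assms(2) unfolding meridionally_colorable_def partially_colored_def by blast
  define k where "k = Suc (card (colored_arcs col))"
  define n where "n = k + (card (strands D) - w)"
  have arcs: "colored_arcs col' = chords D"
    by (auto simp: colored_arcs_def dom' strands_def)
  have circles: "Circle i \<in> dom col" if "Circle i \<in> dom col'" for i
    using coloring_moves_number_arcs[OF moves col(1)] that by blast
  obtain N where N: "inj_on N (chords D)" "N ` chords D \<subseteq> {1..<n}"
    and reached: "\<forall>i\<in>{k..<n}. earned D col' N i"
    using coloring_moves_number_arcs[OF moves col(1)]
    unfolding arcs k_def[symmetric] n_def[symmetric] by (elim conjE exE) (rule that)
  \<comment> \<open>The level of the gap before \<open>x\<close>; the default 0 is taken on circles without arrowheads.\<close>
  define before where "before x =
    (if \<exists>b. along_arc D b x then N (THE b. along_arc D b x) else 0)" for x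
  have before: "before x = N b" if "along_arc D b x" for b x
  proof -
    have "(THE b. along_arc D b x) = b"
      using that along_arc_unique[OF D] by blast
    then show ?thesis
      using that by (auto simp: before_def)
  qed
  define T P where "T c = before (Tail c)" and "P c = before (Head c)" for c
  have entry: "case_endpoint T P x = before x" for x
    by (cases x) (auto simp: T_def P_def)
  have headless: "T c = 0"
    if "v \<in> set (circles D)" "Tail c \<in> set v" "\<And>b. Head b \<notin> set v" for v c
  proof -
    have "\<not> along_arc D b (Tail c)" for b
      using that along_arc_circle[OF _ D, of b "Tail c"] circle_unique[OF D that(1)] by blast
    then show ?thesis
      by (simp add: T_def before_def)
  qed
  have "leveling D T P N k n"
  proof
    show "case_endpoint T N x = case_endpoint T P y" if xy: "directly_after D x y" for x y
    proof (cases x)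
      case (Tail c)
      then have "along_arc D b y \<longleftrightarrow> along_arc D b x" for b
        using along_arc_pass_tail_iff[OF D] xy by blast
      then show ?thesis
        using Tail unfolding entry by (simp add: T_def before_def)
    next
      case (Head b)
      then show ?thesis
        using before[of b y] xy along_arc.first[of D b y] unfolding entry by simp
    qed
    show "T c < n" if "c \<in> chords D" for c
    proof (cases "\<exists>b. along_arc D b (Tail c)")
      case True
      then obtain b where b: "along_arc D b (Tail c)" by blast
      then have "b \<in> chords D"
        using along_arc_circle[OF b D] by (auto simp: chords_iff_Head[OF D] endpoints_def)
      then show ?thesis
        using before[OF b] N(2) by (auto simp: T_def)
    next
      case False
      then show ?thesis
        by (simp add: T_def before_def n_def k_def)
    qed
    show "\<exists>c\<in>chords D. T c < i \<and> (N c = i \<and> P c < i \<or> P c = i \<and> N c < i)"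
      if i: "k \<le> i" "i < n" for i
    proof -
      obtain c s b where c: "c \<in> chords D" "s \<in> strands D" "tail_on_strand D c s"
        "\<And>b. s = Arc b \<Longrightarrow> N b < i" "along_arc D b (Head c)"
        "N c = i \<and> N b < i \<or> N b = i \<and> N c < i"
        using bspec[OF reached, of i] i unfolding earned_def arcs dom' by auto
      have "T c < i"
      proof (cases s)
        case (Arc a)
        then show ?thesis
          using c(3,4) before[of a "Tail c"] by (simp add: T_def)
      next
        case (Circle a)
        then have "T c = 0"
          using c(2,3) by (intro headless[of "circles D ! a"]) (auto simp: strands_def)
        then show ?thesis
          using i by (simp add: k_def)
      qed
      then show ?thesis
        using c before[OF c(5)] by (auto simp: P_def)
    qed
  qed (use D N headless in \<open>auto simp: inj_on_def Suc_le_eq\<close>)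
  moreover have "card (headless_circles D) + (k - 1) = w"
  proof -
    have "dom col = Circle ` headless_circles D \<union> Arc ` colored_arcs col"
    proof
      show "dom col \<subseteq> Circle ` headless_circles D \<union> Arc ` colored_arcs col"
        using col(1) by (auto simp: strands_def headless_circles_def colored_arcs_def)
      have "Circle i \<in> dom col" if "i \<in> headless_circles D" for i
        using that by (intro circles) (simp add: dom' strands_def headless_circles_def)
      then show "Circle ` headless_circles D \<union> Arc ` colored_arcs col \<subseteq> dom col"
        by (auto simp: colored_arcs_def)
    qed
    moreover have "colored_arcs col \<subseteq> chords D"
      using col(1) by (auto simp: colored_arcs_def strands_def)
    then have "finite (colored_arcs col)"
      using finite_chords finite_subset by blast
    moreover have "finite (headless_circles D)"
      by (simp add: headless_circles_def)
    moreover have "inj_on Circle (headless_circles D)" "inj_on Arc (colored_arcs col)"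
      by (simp_all add: inj_on_def)
    ultimately have "card (dom col) = card (headless_circles D) + card (colored_arcs col)"
      using card_Un_disjoint[of "Circle ` headless_circles D" "Arc ` colored_arcs col"]
      by (auto simp: card_image)
    then show ?thesis
      using col(2) by (simp add: k_def)
  qed
  ultimately show ?thesis
    by (intro exI[of _ T] exI[of _ P] exI[of _ N] exI[of _ k] exI[of _ n]) (auto simp: k_def n_def)
qed

lemma ex_vb_diagram_le_wirtinger_diagram:
  assumes D: "gauss_diagram D" and tails: "tail_on_each_circle D"
  shows "\<exists>D'. (D, D') \<in> gauss_equiv \<and> tail_on_each_circle D' \<and> vb_diagram D' \<le> wirtinger_diagram D"
proof -
  have "wirtinger_diagram D \<in> {k. meridionally_colorable k D}"
    unfolding wirtinger_diagram_def
    using meridionally_colorable_card_strands by (intro Inf_nat_def1) blast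
  then obtain T P Q k n where lev: "leveling D T P Q k n" "0 < k" "k \<le> n"
    and k: "card (headless_circles D) + (k - 1) = wirtinger_diagram D"
    using ex_leveling[OF D] by blast
  obtain D' T' P' Q' where "(D, D') \<in> gauss_equiv" "tail_on_each_circle D'"
    "headless_circles D' = headless_circles D" "leveling D' T' P' Q' k k"
    using lower_levels[OF lev tails] by blast
  then show ?thesis
    using vb_diagram_le_levels k by metis
qed

theorem theorem3p3:
  fixes L :: "gauss_code set"
  assumes "L \<in> virtual_links"
  shows "wirtinger_number L = virtual_bridge_number L"
proof (rule antisym)
  let ?L = "{D \<in> L. tail_on_each_circle D}"
  have diagram: "gauss_diagram D" if "D \<in> L" for D
    using assms that in_quotient_imp_subset[OF equiv_gauss_equiv]
    unfolding virtual_links_def by blast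
  have closed: "D' \<in> L" if "D \<in> L" "(D, D') \<in> gauss_equiv" for D D'
    using assms that in_quotient_imp_closed[OF equiv_gauss_equiv]
    unfolding virtual_links_def by blast
  have ne: "?L \<noteq> {}"
    using virtual_link_has_tail_on_each_circle[OF assms] by blast
  show "wirtinger_number L \<le> virtual_bridge_number L"
  proof -
    have "virtual_bridge_number L \<in> vb_diagram ` ?L"
      unfolding virtual_bridge_number_def using ne by (intro Inf_nat_def1) blast
    then obtain D where D: "D \<in> ?L" "vb_diagram D = virtual_bridge_number L"
      by auto
    have "wirtinger_number L \<le> wirtinger_diagram D"
      unfolding wirtinger_number_def using D by (intro wellorder_Inf_le1) blast
    also have "\<dots> \<le> vb_diagram D"
      using D diagram by (intro wirtinger_diagram_le_vb_diagram) auto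
    finally show ?thesis
      using D by simp
  qed
  show "virtual_bridge_number L \<le> wirtinger_number L"
  proof -
    have "wirtinger_number L \<in> wirtinger_diagram ` ?L"
      unfolding wirtinger_number_def using ne by (intro Inf_nat_def1) blast
    then obtain D where D: "D \<in> ?L" "wirtinger_diagram D = wirtinger_number L"
      by auto
    then obtain D' where D': "(D, D') \<in> gauss_equiv" "tail_on_each_circle D'"
      "vb_diagram D' \<le> wirtinger_diagram D"
      using ex_vb_diagram_le_wirtinger_diagram diagram by blast
    then have "virtual_bridge_number L \<le> vb_diagram D'"
      unfolding virtual_bridge_number_def using D closed by (intro wellorder_Inf_le1) blast
    then show ?thesis
      using D D' by simp
  qed
qed

end
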